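(* For each of the quadruples $$(\kappa,\iota,\eta,\delta)\in\{(0,6,0,3),\ (0,6,1,2),\ (1,4,0,2),\ (1,4,1,1),\ (2,2,0,1),\ (2,2,1,0),\ (3,0,0,0)\}$$ there is a (real) maximally inflected plane quartic with $\kappa$ cusps, $\iota$ inflection points (flexes), $\eta$ real nodes, and $\delta$ solitary points.
   Context: A rational plane quartic is a morphism $\varphi=[\varphi_0,\varphi_1,\varphi_2]:\mathbb{P}^1\to\mathbb{P}^2$ given by three coprime, linearly independent binary forms of degree $4$ (over $\mathbb{C}$), up to projective transformations of $\mathbb{P}^2$. The ramification sequence of $\varphi$ at $s\in\mathbb{P}^1$ is $(0,\alpha_1,\alpha_2)$, $0<\alpha_1<\alpha_2$, such that in suitable coordinates of $\mathbb{P}^2$ the components of $\varphi$ vanish at $s$ to orders exactly $0,\alpha_1,\alpha_2$. The point $s$ is a ramification point if this is not $(0,1,2)$; it is a flex if it is $(0,1,3)$ and a cusp if it is $(0,2,3)$. The curve is maximally inflected if $\varphi$ is real (given by real forms) and all of its ramification points lie in $\mathbb{RP}^1$. A real node is an ordinary double point of the image curve lying in $\mathbb{RP}^2$ with two real tangents; a solitary point is an ordinary double point in $\mathbb{RP}^2$ with complex conjugate tangents. *)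

theory Defs
  imports "HOL-Analysis.Analysis" "HOL-Computational_Algebra.Polynomial"
begin

text \<open>
  Points of a complex projective space are the one-dimensional subspaces of \<open>complex ^ 'n\<close>, so
  \<open>proj_points :: (complex ^ 2) set set\<close> is the projective line and
  \<open>proj_points :: (complex ^ 3) set set\<close> the projective plane.  Lines of the plane are the
  two-dimensional subspaces of \<open>complex ^ 3\<close>.
\<close>

definition proj_points :: "(complex ^ 'n::finite) set set" where
  "proj_points = {vec.span {v} | v. v \<noteq> 0}"

text \<open>A point or line is real if it is spanned by vectors with real coordinates; in particular
  the real elements of \<^const>\<open>proj_points\<close> are the points with real homogeneous coordinates.\<close>

definition real_subspace :: "(complex ^ 'n::finite) set \<Rightarrow> bool" where
  "real_subspace L \<longleftrightarrow> (\<exists>B. (\<forall>v\<in>B. \<forall>i. v $ i \<in> \<real>) \<and> L = vec.span B)"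

definition conj_subspace :: "(complex ^ 'n::finite) set \<Rightarrow> (complex ^ 'n) set" where
  "conj_subspace L = (\<lambda>v. \<chi> i. cnj (v $ i)) ` L"

text \<open>A polynomial in two variables \<open>x\<close>, \<open>y\<close> has type \<open>complex poly poly\<close>: the outer variable
  is \<open>y\<close>, the inner one is \<open>x\<close>, and \<open>coeff (coeff F j) i\<close> is the coefficient of
  \<open>x\<^sup>i y\<^sup>j\<close>.\<close>

definition binary_form :: "nat \<Rightarrow> complex poly poly \<Rightarrow> bool" where
  "binary_form d F \<longleftrightarrow> (\<forall>i j. coeff (coeff F j) i \<noteq> 0 \<longrightarrow> i + j = d)"

definition eval_form :: "complex poly poly \<Rightarrow> complex ^ 2 \<Rightarrow> complex" where
  "eval_form F v = poly (poly F [:v $ 2:]) (v $ 1)"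

definition partial_x :: "complex poly poly \<Rightarrow> complex poly poly" where
  "partial_x F = map_poly pderiv F"

definition partial_y :: "complex poly poly \<Rightarrow> complex poly poly" where
  "partial_y F = pderiv F"

text \<open>The linear form \<open>b x - a y\<close> whose only zero in the projective line is \<open>[a, b]\<close>; a form
  vanishes at \<open>[a, b]\<close> to order exactly \<open>n\<close> iff this factor occurs in it exactly \<open>n\<close> times.\<close>

definition linear_form_at :: "complex ^ 2 \<Rightarrow> complex poly poly" where
  "linear_form_at v = [:[:0, v $ 2:], [:- (v $ 1):]:]"

definition vanishes_to_order :: "complex ^ 2 \<Rightarrow> nat \<Rightarrow> complex poly poly \<Rightarrow> bool" where
  "vanishes_to_order v n F \<longleftrightarrow>
     linear_form_at v ^ n dvd F \<and> \<not> linear_form_at v ^ Suc n dvd F"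

definition lin_comb :: "complex ^ 3 \<Rightarrow> (complex poly poly) ^ 3 \<Rightarrow> complex poly poly" where
  "lin_comb c \<phi> = (\<Sum>k\<in>UNIV. smult [:c $ k:] (\<phi> $ k))"

definition rational_plane_quartic :: "(complex poly poly) ^ 3 \<Rightarrow> bool" where
  "rational_plane_quartic \<phi> \<longleftrightarrow>
     (\<forall>k. binary_form 4 (\<phi> $ k)) \<and>
     (\<forall>D. (\<forall>k. D dvd \<phi> $ k) \<longrightarrow> is_unit D) \<and>
     (\<forall>c. lin_comb c \<phi> = 0 \<longrightarrow> c = 0)"

text \<open>\<open>A\<close> is the change of coordinates in the plane; the components of the curve in the new
  coordinates are the combinations of the old ones given by the rows of \<open>A\<close>.\<close>

definition has_ramification_sequence ::
    "(complex poly poly) ^ 3 \<Rightarrow> (complex ^ 2) set \<Rightarrow> nat \<times> nat \<times> nat \<Rightarrow> bool" where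
  "has_ramification_sequence \<phi> s = (\<lambda>(\<alpha>0, \<alpha>1, \<alpha>2).
     \<alpha>0 = 0 \<and> 0 < \<alpha>1 \<and> \<alpha>1 < \<alpha>2 \<and>
     (\<exists>v A. v \<noteq> 0 \<and> s = vec.span {v} \<and> invertible (A :: complex ^ 3 ^ 3) \<and>
        vanishes_to_order v \<alpha>0 (lin_comb (A $ 1) \<phi>) \<and>
        vanishes_to_order v \<alpha>1 (lin_comb (A $ 2) \<phi>) \<and>
        vanishes_to_order v \<alpha>2 (lin_comb (A $ 3) \<phi>)))"

definition ramification_point :: "(complex poly poly) ^ 3 \<Rightarrow> (complex ^ 2) set \<Rightarrow> bool" where
  "ramification_point \<phi> s \<longleftrightarrow> s \<in> proj_points \<and> \<not> has_ramification_sequence \<phi> s (0, 1, 2)"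

definition flex :: "(complex poly poly) ^ 3 \<Rightarrow> (complex ^ 2) set \<Rightarrow> bool" where
  "flex \<phi> s \<longleftrightarrow> s \<in> proj_points \<and> has_ramification_sequence \<phi> s (0, 1, 3)"

definition cusp :: "(complex poly poly) ^ 3 \<Rightarrow> (complex ^ 2) set \<Rightarrow> bool" where
  "cusp \<phi> s \<longleftrightarrow> s \<in> proj_points \<and> has_ramification_sequence \<phi> s (0, 2, 3)"

definition maximally_inflected_quartic :: "(complex poly poly) ^ 3 \<Rightarrow> bool" where
  "maximally_inflected_quartic \<phi> \<longleftrightarrow>
     rational_plane_quartic \<phi> \<and>
     (\<forall>k i j. coeff (coeff (\<phi> $ k) j) i \<in> \<real>) \<and>
     (\<forall>s. ramification_point \<phi> s \<longrightarrow> real_subspace s)"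

text \<open>The image of the point \<open>s\<close>.  By homogeneity all nonzero vectors of the line \<open>s\<close> have
  proportional values, so the span is the line through any one of these values.\<close>

definition curve_point :: "(complex poly poly) ^ 3 \<Rightarrow> (complex ^ 2) set \<Rightarrow> (complex ^ 3) set" where
  "curve_point \<phi> s = vec.span ((\<lambda>v. \<chi> k. eval_form (\<phi> $ k) v) ` s)"

text \<open>The image of the differential of the polynomial map from
  \<open>complex ^ 2\<close> to \<open>complex ^ 3\<close> along \<open>s\<close>.  By Euler's formula it contains
  \<open>curve_point \<phi> s\<close>; the branch of the curve at \<open>s\<close> is smooth iff the dimension is 2, and
  then this is its tangent line.\<close>

definition branch_tangent :: "(complex poly poly) ^ 3 \<Rightarrow> (complex ^ 2) set \<Rightarrow> (complex ^ 3) set" where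
  "branch_tangent \<phi> s =
     vec.span ((\<lambda>v. \<chi> k. eval_form (partial_x (\<phi> $ k)) v) ` s \<union>
               (\<lambda>v. \<chi> k. eval_form (partial_y (\<phi> $ k)) v) ` s)"

text \<open>\<open>P\<close> is an ordinary double point of the image curve with tangents \<open>T1\<close>, \<open>T2\<close>: exactly two
  branches pass through \<open>P\<close>, both are smooth, and their tangents are distinct.  Branches are
  identified with parameters, which is legitimate if \<open>\<phi>\<close> is birational onto its image;
  otherwise a quartic \<open>\<phi>\<close> is a double cover of a smooth conic, there are no double points, and
  the condition fails since parameters with the same image have the same tangent.\<close>

definition ordinary_double_point ::
    "(complex poly poly) ^ 3 \<Rightarrow> (complex ^ 3) set \<Rightarrow> (complex ^ 3) set \<Rightarrow> (complex ^ 3) set \<Rightarrow> bool" where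
  "ordinary_double_point \<phi> P T1 T2 \<longleftrightarrow>
     P \<in> proj_points \<and>
     (\<exists>s t. s \<noteq> t \<and> {u \<in> proj_points. curve_point \<phi> u = P} = {s, t} \<and>
        T1 = branch_tangent \<phi> s \<and> T2 = branch_tangent \<phi> t \<and>
        vec.dim T1 = 2 \<and> vec.dim T2 = 2 \<and> T1 \<noteq> T2)"

definition real_node :: "(complex poly poly) ^ 3 \<Rightarrow> (complex ^ 3) set \<Rightarrow> bool" where
  "real_node \<phi> P \<longleftrightarrow> real_subspace P \<and>
     (\<exists>T1 T2. ordinary_double_point \<phi> P T1 T2 \<and> real_subspace T1 \<and> real_subspace T2)"

definition solitary_point :: "(complex poly poly) ^ 3 \<Rightarrow> (complex ^ 3) set \<Rightarrow> bool" where
  "solitary_point \<phi> P \<longleftrightarrow> real_subspace P \<and>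
     (\<exists>T1 T2. ordinary_double_point \<phi> P T1 T2 \<and> T2 = conj_subspace T1)"

text \<open>Finiteness is explicit because \<^const>\<open>card\<close> is 0 on infinite sets.\<close>

definition has_exactly :: "nat \<Rightarrow> 'a set \<Rightarrow> bool" where
  "has_exactly n S \<longleftrightarrow> finite S \<and> card S = n"

end

theory Submission
  imports Defs "HOL-Computational_Algebra.Fundamental_Theorem_Algebra"
begin

text \<open>
  The quadratic Cremona transformation maps a conic \<open>[q\<^sub>1, q\<^sub>2, q\<^sub>3]\<close> in general position to the rational
  quartic \<open>[q\<^sub>2 q\<^sub>3, q\<^sub>3 q\<^sub>1, q\<^sub>1 q\<^sub>2]\<close>.  Its only double points are the vertices of the coordinate
  triangle, whose parameters are the roots of the \<open>q\<^sub>k\<close>: the vertex is a real node, a solitary point or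
  a cusp as the discriminant of \<open>q\<^sub>k\<close> is positive, negative or zero.  The ramification is read off
  from the Wronskian, a form of degree 6 with a double root at each cusp and a simple root at each
  flex.  So it suffices to choose the three real quadratics with the right discriminants and a
  Wronskian whose remaining roots are real, which is certified by sign changes.
\<close>

subsection \<open>Binary forms and their dehomogenisations\<close>

text \<open>The three vertices account for all nodes, solitary points and cusps, and a Wronskian of
  degree 6 leaves 6 - 2 kappa flexes; hence kappa + eta + delta = 3 and iota = 6 - 2 kappa in every
  listed quadruple. That there are no further double points has two sources. The Cremona map is
  injective off the triangle, so two parameters with a common image must both meet the same side.
  Pairwise coprime quadratics keep the conic away from the vertices, so the quartic has no base
  point and each side contributes its own vertex only. The counts are exact and range over all
  complex parameters. Exhibiting sequences at chosen points is therefore not enough: the sequence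
  has to be unique, and it has to be known everywhere, infinity included. The examples are placed so
  that infinity is unramified and maps to no double point; the rest is read off univariate
  polynomials in the coordinate t of [t, 1]. Real polynomials carry the identities and sign changes,
  their complexifications the geometry.\<close>

definition homogenize :: "nat \<Rightarrow> complex poly \<Rightarrow> complex poly poly" where
  "homogenize d p = (\<Sum>i\<le>d. monom (monom (coeff p i) i) (d - i))"

lemma coeff_homogenize:
  "coeff (homogenize d p) j = (if j \<le> d then monom (coeff p (d - j)) (d - j) else 0)"
proof -
  have "coeff (homogenize d p) j = (\<Sum>i\<le>d. if d - i = j then monom (coeff p i) i else 0)"
    by (simp add: homogenize_def coeff_sum)
  also have "\<dots> = (\<Sum>i\<le>d. if i = d - j \<and> j \<le> d then monom (coeff p i) i else 0)"
    by (rule sum.cong) auto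
  also have "\<dots> = (if j \<le> d then monom (coeff p (d - j)) (d - j) else 0)"
    by (cases "j \<le> d") (auto simp: sum.delta)
  finally show ?thesis .
qed

lemma coeff_coeff_homogenize:
  "coeff (coeff (homogenize d p) j) i = (if i + j = d then coeff p i else 0)"
  by (auto simp: coeff_homogenize)

lemma coeff_linear_mult:
  fixes p :: "'a::comm_semiring_0 poly"
  shows "coeff ([:a, b:] * p) n = a * coeff p n + (case n of 0 \<Rightarrow> 0 | Suc m \<Rightarrow> b * coeff p m)"
  by (cases n) (auto simp: algebra_simps)

lemma coeff_const_mult: "coeff ([:a:] * p) n = a * coeff p n"
  by simp

lemma homogenize_mult_linear:
  assumes "degree p \<le> d"
  shows "homogenize (Suc d) ([:- t, 1:] * p) = linear_form_at (vector [t, 1]) * homogenize d p"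
proof (rule poly_eqI, rule poly_eqI)
  fix j i
  have 0: "coeff p i = 0" if "i > d" for i
    using assms that by (simp add: coeff_eq_0)
  show "coeff (coeff (homogenize (Suc d) ([:- t, 1:] * p)) j) i =
        coeff (coeff (linear_form_at (vector [t, 1]) * homogenize d p) j) i"
    unfolding linear_form_at_def coeff_linear_mult coeff_coeff_homogenize
    by (cases j; cases i)
       (auto simp: coeff_linear_mult coeff_const_mult coeff_coeff_homogenize 0 coeff_pCons simp del: mult_pCons_left split: nat.splits)
qed

lemma homogenize_mult_linear_power:
  assumes "degree p \<le> d"
  shows "homogenize (d + n) ([:- t, 1:] ^ n * p) = linear_form_at (vector [t, 1]) ^ n * homogenize d p"
proof (induction n)
  case (Suc n)
  have "degree ([:- t, 1:] ^ n * p) \<le> degree ([:- t, 1:] ^ n) + degree p"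
    by (rule degree_mult_le)
  also have "degree ([:- t, 1:] ^ n) \<le> degree [:- t, 1:] * n"
    by (rule degree_power_le)
  finally have "degree ([:- t, 1:] ^ n * p) \<le> d + n"
    using assms by simp
  then show ?case
    using homogenize_mult_linear[of "[:- t, 1:] ^ n * p" "d + n" t] Suc
    by (simp add: mult.assoc del: mult_pCons_left)
qed simp

text \<open>The degree bound matters because \<open>homogenize\<close> silently drops the
  coefficients above \<open>d\<close>.\<close>

lemma poly_homogenize_1:
  assumes "degree p \<le> d"
  shows "poly (homogenize d p) 1 = p"
proof -
  have "poly (homogenize d p) 1 = (\<Sum>i\<le>d. monom (coeff p i) i)"
    by (simp add: homogenize_def poly_sum poly_monom)
  also have "\<dots> = p"
    using assms by (rule poly_as_sum_of_monoms')
  finally show ?thesis .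
qed

lemma eval_homogenize:
  "eval_form (homogenize d p) v = (\<Sum>i\<le>d. coeff p i * v $ 1 ^ i * v $ 2 ^ (d - i))"
  by (simp add: eval_form_def homogenize_def poly_sum poly_monom poly_power mult_ac)

lemma eval_homogenize_scale:
  "eval_form (homogenize d p) (c *s v) = c ^ d * eval_form (homogenize d p) v"
proof -
  have "c ^ i * c ^ (d - i) = c ^ d" if "i \<le> d" for i
    using that by (simp flip: power_add)
  then show ?thesis
    by (auto simp: eval_homogenize sum_distrib_left power_mult_distrib mult_ac intro!: sum.cong)
qed

lemma eval_homogenize_finite:
  assumes "degree p \<le> d"
  shows "eval_form (homogenize d p) (vector [t, 1]) = poly p t"
proof -
  have "poly p t = poly (\<Sum>i\<le>d. monom (coeff p i) i) t"
    using poly_as_sum_of_monoms'[OF assms] by simp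
  then show ?thesis
    by (simp add: eval_homogenize poly_sum poly_monom)
qed

lemma eval_homogenize_infinity:
  "eval_form (homogenize d p) (vector [1, 0]) = coeff p d"
proof -
  have "eval_form (homogenize d p) (vector [1, 0]) = (\<Sum>i\<le>d. if i = d then coeff p i else 0)"
    unfolding eval_homogenize by (rule sum.cong) auto
  then show ?thesis by simp
qed

lemma vector_2_eq_iff:
  fixes v w :: "'a ^ 2"
  shows "v = w \<longleftrightarrow> v $ 1 = w $ 1 \<and> v $ 2 = w $ 2"
  by (simp add: vec_eq_iff forall_2)

text \<open>Reduces coprimality of the components to the absence of common zeros. A common divisor
  is not known to be a form, so a zero other than the origin has to be found for an arbitrary
  polynomial in two variables.\<close>

lemma nonunit_has_zero:
  fixes D :: "complex poly poly"
  assumes "D \<noteq> 0" "\<not> is_unit D"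
  obtains v where "v \<noteq> 0" "eval_form D v = 0"
proof (cases "degree D = 0")
  case True
  then obtain d where D: "D = [:d:]" by (rule degree_eq_zeroE)
  then have "\<not> is_unit d" "d \<noteq> 0" using assms by (auto simp: is_unit_const_poly_iff)
  then have "degree d \<noteq> 0" by (auto simp: is_unit_iff_degree)
  then have "\<not> constant (poly d)" by (simp add: constant_degree)
  then obtain x where "poly d x = 0"
    using fundamental_theorem_of_algebra by blast
  then show thesis
    using that[of "vector [x, 1]"] by (simp add: D eval_form_def vector_2_eq_iff)
next
  case False
  \<comment> \<open>A value of x that is no root of the leading coefficient preserves the degree in
    y, and a nonzero one keeps the resulting zero away from the origin.\<close>
  have "infinite (UNIV - insert 0 {x. poly (lead_coeff D) x = 0})"
    using assms(1) by (intro Diff_infinite_finite finite.insertI poly_roots_finite infinite_UNIV_char_0) simp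
  then have "UNIV - insert 0 {x. poly (lead_coeff D) x = 0} \<noteq> {}"
    using finite.emptyI by metis
  then obtain x where x: "x \<noteq> 0" "poly (lead_coeff D) x \<noteq> 0"
    by blast
  define h where "h = map_poly (\<lambda>p. poly p x) D"
  have "coeff h (degree D) \<noteq> 0"
    using x by (simp add: h_def coeff_map_poly)
  then have "degree h \<noteq> 0"
    using False le_degree[of h "degree D"] by auto
  then have "\<not> constant (poly h)" by (simp add: constant_degree)
  then obtain y where "poly h y = 0"
    using fundamental_theorem_of_algebra by blast
  moreover have "poly (poly D [:y:]) x = poly h y"
    unfolding h_def by (induction D) (simp_all add: map_poly_pCons)
  ultimately show thesis
    using that[of "vector [x, y]"] x(1) by (simp add: eval_form_def vector_2_eq_iff)
qed

lemma binary_form_homogenize: "binary_form d (homogenize d p)"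
  by (simp add: binary_form_def coeff_coeff_homogenize)

lemma partial_x_homogenize: "partial_x (homogenize (Suc d) p) = homogenize d (pderiv p)"
  by (intro poly_eqI)
     (simp add: partial_x_def coeff_map_poly coeff_pderiv coeff_coeff_homogenize)

text \<open>Euler's formula on y = 1: the y-derivative of a form of degree d + 1 becomes (d + 1) p -
  x p'.\<close>

lemma partial_y_homogenize:
  "partial_y (homogenize (Suc d) p) = homogenize d (smult (of_nat (Suc d)) p - pCons 0 (pderiv p))"
proof (intro poly_eqI)
  fix j i
  show "coeff (coeff (partial_y (homogenize (Suc d) p)) j) i =
    coeff (coeff (homogenize d (smult (of_nat (Suc d)) p - pCons 0 (pderiv p))) j) i"
    by (cases i) (auto simp: partial_y_def coeff_pderiv coeff_coeff_homogenize algebra_simps coeff_pCons of_nat_poly)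
qed

lemma lin_comb_homogenize:
  "lin_comb c (\<chi> k. homogenize d (f k)) = homogenize d (\<Sum>k\<in>UNIV. smult (c $ k) (f k))"
  by (intro poly_eqI) (simp add: lin_comb_def coeff_sum coeff_coeff_homogenize)

text \<open>Multiplicativity of \<open>homogenize\<close> gives enough factors. There is no further
  one because setting y = 1 is a ring homomorphism that sends the linear form to
  \<open>[:- t, 1:]\<close>, so an extra factor would raise the order of \<open>p\<close>.\<close>

lemma vanishes_to_order_finite:
  assumes "degree p \<le> d" "p \<noteq> 0" "order t p = n"
  shows "vanishes_to_order (vector [t, 1]) n (homogenize d p)"
proof -
  obtain q where q: "p = [:- t, 1:] ^ n * q" "\<not> [:- t, 1:] dvd q"
    using order_decomp[OF assms(2), of t] assms(3) by blast
  then have "q \<noteq> 0" by auto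
  then have "degree p = n + degree q"
    using q by (simp add: degree_mult_eq degree_power_eq)
  then have deg: "degree q \<le> d - n" "d - n + n = d"
    using assms(1) by auto
  have 1: "linear_form_at (vector [t, 1]) ^ n dvd homogenize d p"
    using homogenize_mult_linear_power[OF deg(1), of n t] deg(2) q(1) by simp
  have "\<not> linear_form_at (vector [t, 1]) ^ Suc n dvd homogenize d p"
  proof
    assume "linear_form_at (vector [t, 1]) ^ Suc n dvd homogenize d p"
    then obtain r where "homogenize d p = linear_form_at (vector [t, 1]) ^ Suc n * r" ..
    then have "p = poly (linear_form_at (vector [t, 1]) ^ Suc n * r) 1"
      using poly_homogenize_1[OF assms(1)] by simp
    also have "\<dots> = [:- t, 1:] ^ Suc n * poly r 1"
      unfolding poly_mult poly_power by (simp add: linear_form_at_def)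
    finally have "[:- t, 1:] ^ Suc n dvd p" by (metis dvd_triv_left)
    then show False
      using order_2[OF assms(2), of t] assms(3) by simp
  qed
  with 1 show ?thesis by (simp add: vanishes_to_order_def)
qed

lemma linear_form_at_infinity_power_dvd:
  "linear_form_at (vector [1, 0]) ^ n dvd F \<longleftrightarrow> (\<forall>k<n. coeff F k = 0)"
proof -
  \<comment> \<open>At infinity the linear form is -y, so orders of vanishing are lowest exponents
    of y and are read off the top coefficients of the dehomogenised polynomial.\<close>
  have "linear_form_at (vector [1, 0]) = - monom 1 1"
    by (simp add: linear_form_at_def monom_altdef one_pCons)
  then show ?thesis
    by (simp add: uminus_power_if monom_power monom_1_dvd_iff')
qed

lemma vanishes_to_order_infinity:
  assumes "\<And>i. i < n \<Longrightarrow> coeff p (d - i) = 0" "coeff p (d - n) \<noteq> 0" "n \<le> d"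
  shows "vanishes_to_order (vector [1, 0]) n (homogenize d p)"
  unfolding vanishes_to_order_def linear_form_at_infinity_power_dvd
  using assms by (auto simp: coeff_homogenize)

subsection \<open>Points of the projective line\<close>

definition line_point :: "complex \<Rightarrow> (complex ^ 2) set" where
  "line_point t = vec.span {vector [t, 1]}"

definition line_infinity :: "(complex ^ 2) set" where
  "line_infinity = vec.span {vector [1, 0]}"

lemma span_scale:
  fixes v :: "'a::field ^ 'n"
  assumes "c \<noteq> 0"
  shows "vec.span {c *s v} = vec.span {v}"
proof -
  have "x \<in> range (\<lambda>k. k *s (c *s v))" if "x \<in> range (\<lambda>k. k *s v)" for x
  proof -
    from that obtain k where "x = k *s v" by auto
    then have "x = (k / c) *s (c *s v)" using assms by (simp add: vector_smult_assoc)
    then show ?thesis by blast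
  qed
  then show ?thesis
    unfolding vec.span_singleton by (auto simp: vector_smult_assoc)
qed

lemma span_singleton_eqD:
  fixes v w :: "'a::field ^ 'n"
  assumes "vec.span {v} = vec.span {w}" "v \<noteq> 0"
  obtains c where "c \<noteq> 0" "v = c *s w"
proof -
  have "v \<in> vec.span {w}" using assms vec.span_base by blast
  then obtain c where c: "v = c *s w" unfolding vec.span_singleton by auto
  with assms(2) have "c \<noteq> 0" by auto
  with c show thesis using that by blast
qed

lemma line_point_or_infinity:
  fixes v :: "complex ^ 2"
  assumes "v \<noteq> 0"
  obtains c t where "c \<noteq> 0" "v = c *s vector [t, 1]" | c where "c \<noteq> 0" "v = c *s vector [1, 0]"
proof (cases "v $ 2 = 0")
  case True
  with assms have "v $ 1 \<noteq> 0" "v = v $ 1 *s vector [1, 0]"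
    by (auto simp: vector_2_eq_iff)
  then show ?thesis using that by blast
next
  case False
  then have "v = v $ 2 *s vector [v $ 1 / v $ 2, 1]"
    by (auto simp: vector_2_eq_iff)
  with False show ?thesis using that by blast
qed

lemma proj_points_line: "proj_points = insert line_infinity (range line_point)"
proof (rule set_eqI, rule iffI)
  fix s :: "(complex ^ 2) set"
  assume "s \<in> proj_points"
  then obtain v where v: "v \<noteq> 0" "s = vec.span {v}" by (auto simp: proj_points_def)
  from v(1) show "s \<in> insert line_infinity (range line_point)"
  proof (cases rule: line_point_or_infinity)
    case (1 c t)
    then have "s = line_point t" using span_scale v(2) by (metis line_point_def)
    then show ?thesis by blast
  next
    case (2 c)
    then have "s = line_infinity" using span_scale v(2) by (metis line_infinity_def)
    then show ?thesis by blast
  qed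
next
  fix s
  assume "s \<in> insert line_infinity (range line_point)"
  moreover have "vector [t, 1] \<noteq> (0 :: complex ^ 2)" "vector [1, 0] \<noteq> (0 :: complex ^ 2)" for t
    by (simp_all add: vector_2_eq_iff)
  ultimately show "s \<in> proj_points"
    unfolding proj_points_def line_point_def line_infinity_def by blast
qed

lemma line_point_eq_iff [simp]: "line_point t = line_point u \<longleftrightarrow> t = u"
proof
  assume "line_point t = line_point u"
  then have "vec.span {vector [t, 1]} = vec.span {vector [u, 1 :: complex] :: complex ^ 2}"
    by (simp add: line_point_def)
  then obtain c where "c \<noteq> 0" "vector [t, 1] = c *s (vector [u, 1] :: complex ^ 2)"
    by (rule span_singleton_eqD) (simp add: vector_2_eq_iff)
  then show "t = u" by (auto simp: vector_2_eq_iff)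
qed simp

lemma line_point_neq_infinity [simp]: "line_point t \<noteq> line_infinity"
proof
  assume "line_point t = line_infinity"
  then have "vec.span {vector [t, 1]} = vec.span {vector [1, 0 :: complex] :: complex ^ 2}"
    by (simp add: line_point_def line_infinity_def)
  then obtain c where "c \<noteq> 0" "vector [t, 1] = c *s (vector [1, 0] :: complex ^ 2)"
    by (rule span_singleton_eqD) (simp add: vector_2_eq_iff)
  then show False by (auto simp: vector_2_eq_iff)
qed

lemma real_subspace_line_point: "t \<in> \<real> \<Longrightarrow> real_subspace (line_point t)"
  unfolding real_subspace_def line_point_def
  by (rule exI[of _ "{vector [t, 1]}"]) (simp add: forall_2)

subsection \<open>Uniqueness of the ramification sequence\<close>

lemma vanishes_to_order_unique:
  "vanishes_to_order v m F \<Longrightarrow> vanishes_to_order v n F \<Longrightarrow> m = n"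
  unfolding vanishes_to_order_def by (metis Suc_leI le_imp_power_dvd dvd_trans nat_neq_iff)

lemma vanishes_to_order_scale:
  assumes "c \<noteq> 0"
  shows "vanishes_to_order (c *s v) n F \<longleftrightarrow> vanishes_to_order v n F"
proof -
  have 1: "[:[:c:]:] dvd 1" using assms by (simp add: is_unit_const_poly_iff dvd_field_iff)
  have "linear_form_at (c *s v) = [:[:c:]:] * linear_form_at v"
    by (simp add: linear_form_at_def)
  then have "linear_form_at (c *s v) ^ k dvd F \<longleftrightarrow> linear_form_at v ^ k dvd F" for k
    using 1 by (simp add: power_mult_distrib mult_unit_dvd_iff' is_unit_power_iff del: mult_pCons_left)
  then show ?thesis by (simp add: vanishes_to_order_def del: power_Suc)
qed

lemma vanishes_to_order_scale_add:
  assumes "vanishes_to_order v n F" "c \<noteq> 0" "linear_form_at v ^ Suc n dvd G"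
  shows "vanishes_to_order v n (smult [:c:] F + G)"
proof -
  have "linear_form_at v ^ n dvd G"
    using assms(3) by (metis dvd_trans le_imp_power_dvd lessI less_imp_le)
  moreover have "\<not> linear_form_at v ^ Suc n dvd smult [:c:] F"
  proof
    assume "linear_form_at v ^ Suc n dvd smult [:c:] F"
    then have "linear_form_at v ^ Suc n dvd smult [:1 / c:] (smult [:c:] F)"
      by (rule dvd_smult)
    then show False using assms by (simp add: vanishes_to_order_def flip: one_pCons)
  qed
  ultimately show ?thesis
    using assms by (auto simp: vanishes_to_order_def dvd_smult dvd_add_left_iff)
qed

lemma lin_comb_add: "lin_comb (x + y) \<phi> = lin_comb x \<phi> + lin_comb y \<phi>"
proof -
  have "[:(x + y) $ k:] = [:x $ k:] + [:y $ k:]" for k by simp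
  then show ?thesis by (simp only: lin_comb_def smult_add_left sum.distrib)
qed

lemma lin_comb_scale: "lin_comb (c *s x) \<phi> = smult [:c:] (lin_comb x \<phi>)"
  by (intro poly_eqI) (simp add: lin_comb_def coeff_sum sum_distrib_left mult_ac)

lemma vector_matrix_mult_3:
  fixes A :: "'a::comm_semiring_1 ^ 'n ^ 3"
  shows "d v* A = d $ 1 *s A $ 1 + (d $ 2 *s A $ 2 + d $ 3 *s A $ 3)"
  by (simp add: vec_eq_iff vector_matrix_mult_def sum_3 algebra_simps)

text \<open>The sequence is the set of orders realised by the net of linear combinations.\<close>

lemma orders_of_lin_comb:
  fixes A :: "complex ^ 3 ^ 3"
  assumes "invertible A" "a < b" "b < c"
    and A: "vanishes_to_order v a (lin_comb (A $ 1) \<phi>)" "vanishes_to_order v b (lin_comb (A $ 2) \<phi>)"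
      "vanishes_to_order v c (lin_comb (A $ 3) \<phi>)"
  shows "{n. \<exists>x. vanishes_to_order v n (lin_comb x \<phi>)} = {a, b, c}"
proof (rule set_eqI, rule iffI)
  fix n
  assume "n \<in> {n. \<exists>x. vanishes_to_order v n (lin_comb x \<phi>)}"
  then obtain x where x: "vanishes_to_order v n (lin_comb x \<phi>)" by auto
  obtain B where "B ** A = mat 1"
    using assms(1) by (auto simp: invertible_def)
  then obtain d where "d v* A = x"
    using vector_matrix_mul_assoc[of x B A] by auto
  then have eq: "lin_comb x \<phi> = smult [:d $ 1:] (lin_comb (A $ 1) \<phi>) +
      (smult [:d $ 2:] (lin_comb (A $ 2) \<phi>) + smult [:d $ 3:] (lin_comb (A $ 3) \<phi>))"
    by (metis vector_matrix_mult_3 lin_comb_add lin_comb_scale)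
  have dvd: "linear_form_at v ^ k dvd smult [:y:] (lin_comb (A $ i) \<phi>)"
    if "linear_form_at v ^ l dvd lin_comb (A $ i) \<phi>" "k \<le> l" for k l y i
    using that by (meson dvd_smult dvd_trans le_imp_power_dvd)
  \<comment> \<open>The rows of \<open>A\<close> form a basis, and the first nonzero coordinate of
    \<open>x\<close> in it decides the order, the later terms vanishing to higher order. If all
    coordinates are zero, so is the combination, and it has no order.\<close>
  consider "d $ 1 \<noteq> 0" | "d $ 1 = 0" "d $ 2 \<noteq> 0" | "d $ 1 = 0" "d $ 2 = 0" "d $ 3 \<noteq> 0" |
      "d $ 1 = 0" "d $ 2 = 0" "d $ 3 = 0" by blast
  then show "n \<in> {a, b, c}"
  proof cases
    case 1
    have "vanishes_to_order v a (lin_comb x \<phi>)"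
      unfolding eq using A assms(2,3) 1
      by (intro vanishes_to_order_scale_add dvd_add) (auto simp: vanishes_to_order_def simp del: power_Suc intro: dvd)
    with x show ?thesis by (auto dest: vanishes_to_order_unique)
  next
    case 2
    have "vanishes_to_order v b (smult [:d $ 2:] (lin_comb (A $ 2) \<phi>) + smult [:d $ 3:] (lin_comb (A $ 3) \<phi>))"
      using A assms(2,3) 2
      by (intro vanishes_to_order_scale_add) (auto simp: vanishes_to_order_def simp del: power_Suc intro: dvd)
    with x 2 show ?thesis unfolding eq by (auto dest: vanishes_to_order_unique)
  next
    case 3
    have "vanishes_to_order v c (smult [:d $ 3:] (lin_comb (A $ 3) \<phi>) + 0)"
      using A assms(2,3) 3 by (intro vanishes_to_order_scale_add) auto
    with x 3 show ?thesis unfolding eq by (auto dest: vanishes_to_order_unique)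
  next
    case 4
    with x show ?thesis unfolding eq by (simp add: vanishes_to_order_def)
  qed
qed (use A in blast)

text \<open>Exact counts depend on this: \<open>ramification_point\<close> is defined by a negation,
  and a cusp must not be counted as a flex as well. The two witnesses may use different vectors of
  \<open>s\<close>, but these differ by a scalar, which leaves orders unchanged.\<close>

lemma has_ramification_sequence_unique:
  assumes "has_ramification_sequence \<phi> s (a0, a1, a2)" "has_ramification_sequence \<phi> s (b0, b1, b2)"
  shows "(a0, a1, a2) = (b0, b1, b2)"
proof -
  from assms(1) obtain v A where v: "v \<noteq> 0" "s = vec.span {v}" and
    A: "{n. \<exists>x. vanishes_to_order v n (lin_comb x \<phi>)} = {a0, a1, a2}"
    and a: "a0 = 0" "0 < a1" "a1 < a2"
    unfolding has_ramification_sequence_def using orders_of_lin_comb by fastforce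
  from assms(2) obtain w B where w: "w \<noteq> 0" "s = vec.span {w}" and
    B: "{n. \<exists>x. vanishes_to_order w n (lin_comb x \<phi>)} = {b0, b1, b2}"
    and b: "b0 = 0" "0 < b1" "b1 < b2"
    unfolding has_ramification_sequence_def using orders_of_lin_comb by fastforce
  obtain c where "c \<noteq> 0" "v = c *s w"
    using v w span_singleton_eqD by metis
  then have eq: "{0, a1, a2} = {0, b1, b2}"
    using A B a b by (simp add: vanishes_to_order_scale)
  then have "a1 = b1 \<or> a1 = b2" "a2 = b1 \<or> a2 = b2" "b1 = a1 \<or> b1 = a2"
    using a b by (metis insertE insertI1 insert_commute less_irrefl singletonD order.strict_trans)+
  with a b show ?thesis by auto
qed

subsection \<open>Images and tangents\<close>

lemma span_image_span_singleton:
  fixes g :: "complex ^ 'n \<Rightarrow> complex ^ 'm"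
  assumes "\<And>c v. g (c *s v) = c ^ d *s g v"
  shows "vec.span (g ` vec.span {v}) = vec.span {g v}"
proof (subst vec.span_eq, rule conjI)
  show "g ` vec.span {v} \<subseteq> vec.span {g v}"
    by (auto simp: vec.span_singleton assms)
  show "{g v} \<subseteq> vec.span (g ` vec.span {v})"
    by (auto intro!: vec.span_base imageI)
qed

lemma curve_point_homogenize:
  "curve_point (\<chi> k. homogenize d (f k)) (vec.span {v}) = vec.span {\<chi> k. eval_form (homogenize d (f k)) v}"
  unfolding curve_point_def
  by (subst span_image_span_singleton[where d = d]) (simp_all add: vec_eq_iff eval_homogenize_scale)

lemma curve_point_line_point:
  assumes "\<And>k. degree (f k) \<le> d"
  shows "curve_point (\<chi> k. homogenize d (f k)) (line_point t) = vec.span {\<chi> k. poly (f k) t}"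
  using assms by (simp add: line_point_def curve_point_homogenize eval_homogenize_finite)

lemma curve_point_line_infinity:
  "curve_point (\<chi> k. homogenize d (f k)) line_infinity = vec.span {\<chi> k. coeff (f k) d}"
  by (simp add: line_infinity_def curve_point_homogenize eval_homogenize_infinity)

text \<open>At [t, 1] the partial derivatives are f' and, by Euler's formula, (d + 1) f - t f';
  since d + 1 is invertible, they span the same space as f and f'.\<close>

lemma branch_tangent_line_point:
  assumes "\<And>k. degree (f k) \<le> Suc d"
  shows "branch_tangent (\<chi> k. homogenize (Suc d) (f k)) (line_point t) =
    vec.span {\<chi> k. poly (f k) t, \<chi> k. poly (pderiv (f k)) t}"
proof -
  let ?\<phi> = "\<chi> k. homogenize (Suc d) (f k)"
  let ?v = "vector [t, 1] :: complex ^ 2"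
  let ?gx = "\<lambda>v. \<chi> k. eval_form (partial_x (?\<phi> $ k)) v"
  let ?gy = "\<lambda>v. \<chi> k. eval_form (partial_y (?\<phi> $ k)) v"
  let ?F = "\<chi> k. poly (f k) t" and ?D = "\<chi> k. poly (pderiv (f k)) t"
  have x: "vec.span (?gx ` line_point t) = vec.span {?gx ?v}"
    and y: "vec.span (?gy ` line_point t) = vec.span {?gy ?v}"
    unfolding line_point_def
    by (rule span_image_span_singleton[where d = d];
        simp add: vec_eq_iff eval_homogenize_scale partial_x_homogenize partial_y_homogenize)+
  have gx: "?gx ?v = ?D"
    using assms by (simp add: vec_eq_iff partial_x_homogenize eval_homogenize_finite degree_pderiv le_diff_conv)
  have gy: "?gy ?v = of_nat (Suc d) *s ?F + (- t) *s ?D"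
  proof -
    \<comment> \<open>The terms of degree d + 1 cancel, so homogenising to degree \<open>d\<close>
      truncates nothing.\<close>
    have "degree (smult (of_nat (Suc d)) (f k) - pCons 0 (pderiv (f k))) \<le> d" for k
    proof (rule degree_le, intro allI impI)
      fix i assume "d < i"
      then obtain j where j: "i = Suc j" "d \<le> j" by (cases i) auto
      show "coeff (smult (of_nat (Suc d)) (f k) - pCons 0 (pderiv (f k))) i = 0"
      proof (cases "j = d")
        case False
        then have "coeff (f k) (Suc j) = 0"
          using j assms[of k] by (intro coeff_eq_0) linarith
        then show ?thesis using j by (simp add: coeff_pderiv)
      qed (use j in \<open>simp add: coeff_pderiv\<close>)
    qed
    then show ?thesis
      by (simp add: vec_eq_iff partial_y_homogenize eval_homogenize_finite algebra_simps)
  qed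
  have "branch_tangent ?\<phi> (line_point t) = vec.span (?gx ` line_point t \<union> ?gy ` line_point t)"
    by (simp add: branch_tangent_def)
  also have "\<dots> = vec.span {?gx ?v, ?gy ?v}"
    by (simp only: vec.span_Un x y insert_is_Un[of "?gx ?v" "{?gy ?v}"])
  also have "\<dots> = vec.span {?F, ?D}"
  proof (subst vec.span_eq, rule conjI)
    show "{?gx ?v, ?gy ?v} \<subseteq> vec.span {?F, ?D}"
      unfolding gx gy
      by (intro insert_subsetI empty_subsetI vec.span_add vec.span_scale vec.span_base) simp_all
    have D: "?D \<in> vec.span {?gx ?v, ?gy ?v}"
      unfolding gx by (intro vec.span_base insertI1)
    have "of_nat (Suc d) *s ?F = ?gy ?v + t *s ?D"
      unfolding gy by (simp add: vec_eq_iff)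
    also have "\<dots> \<in> vec.span {?gx ?v, ?gy ?v}"
      by (intro vec.span_add vec.span_scale D vec.span_base insertI1 insertI2)
    finally have "inverse (of_nat (Suc d)) *s (of_nat (Suc d) *s ?F) \<in> vec.span {?gx ?v, ?gy ?v}"
      by (rule vec.span_scale)
    then have "?F \<in> vec.span {?gx ?v, ?gy ?v}"
      by (simp add: vector_smult_assoc del: of_nat_Suc)
    with D show "{?F, ?D} \<subseteq> vec.span {?gx ?v, ?gy ?v}" by simp
  qed
  finally show ?thesis .
qed

lemma conj_subspace_span:
  "conj_subspace (vec.span B) = vec.span ((\<lambda>v. \<chi> i. cnj (v $ i)) ` B)" (is "_ = vec.span (?c ` B)")
proof -
  have sub: "?c ` vec.span B \<subseteq> vec.span (?c ` B)" for B :: "(complex ^ 'a) set"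
  proof
    fix y assume "y \<in> ?c ` vec.span B"
    then obtain x where x: "x \<in> vec.span B" "y = ?c x" by auto
    from x(1) have "?c x \<in> vec.span (?c ` B)"
    proof (induction rule: vec.span_induct_alt)
      case base
      have "?c 0 = 0" by (simp add: vec_eq_iff)
      then show ?case by (simp add: vec.span_zero)
    next
      case (step a u w)
      have "?c (a *s u + w) = cnj a *s ?c u + ?c w" by (simp add: vec_eq_iff)
      moreover have "cnj a *s ?c u \<in> vec.span (?c ` B)"
        using step by (intro vec.span_scale vec.span_base imageI)
      ultimately show ?case
        using vec.span_add step by metis
    qed
    with x show "y \<in> vec.span (?c ` B)" by simp
  qed
  \<comment> \<open>Conjugation is an involution, so \<open>sub\<close> applied to the conjugated
    set yields the reverse inclusion.\<close>
  have cc: "?c ` ?c ` S = S" for S :: "(complex ^ 'a) set"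
    by (simp add: image_image)
  have "vec.span (?c ` B) = ?c ` ?c ` vec.span (?c ` B)"
    by (simp only: cc)
  also have "\<dots> \<subseteq> ?c ` vec.span (?c ` ?c ` B)"
    by (intro image_mono sub)
  finally show ?thesis
    using sub[of B] by (auto simp: conj_subspace_def cc)
qed

lemma conj_subspace_real:
  assumes "real_subspace L"
  shows "conj_subspace L = L"
proof -
  obtain B where B: "\<forall>v\<in>B. \<forall>i. v $ i \<in> \<real>" "L = vec.span B"
    using assms by (auto simp: real_subspace_def)
  then have "(\<lambda>v. \<chi> i. cnj (v $ i)) ` B = (\<lambda>v. v) ` B"
    by (intro image_cong) (auto simp: vec_eq_iff Reals_cnj_iff)
  with B show ?thesis by (simp add: conj_subspace_span)
qed

subsection \<open>Ramification and the Wronskian\<close>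

text \<open>Supplies the coordinates of the plane: when the rows of \<open>J\<close> are derivative
  vectors of the curve, the rows of \<open>A\<close> are the dual basis, so each new component sees
  exactly one of them.\<close>

lemma dual_matrix:
  fixes J :: "'a::field ^ 'n ^ 'n"
  assumes "det J \<noteq> 0"
  obtains A where "invertible A" "\<And>i j. (\<Sum>k\<in>UNIV. A $ i $ k * J $ j $ k) = (if i = j then 1 else 0)"
proof -
  obtain B where B: "J ** B = mat 1" "B ** J = mat 1"
    using assms by (auto simp: invertible_det_nz[symmetric] invertible_def)
  show thesis
  proof (rule that[of "transpose B"])
    show "invertible (transpose B)"
      using B by (auto simp: invertible_def simp flip: matrix_transpose_mul intro!: exI[of _ "transpose J"])
    fix i j
    have "(\<Sum>k\<in>UNIV. transpose B $ i $ k * J $ j $ k) = (J ** B) $ j $ i"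
      by (simp add: matrix_matrix_mult_def transpose_def mult.commute)
    then show "(\<Sum>k\<in>UNIV. transpose B $ i $ k * J $ j $ k) = (if i = j then 1 else 0)"
      by (auto simp: B mat_def)
  qed
qed

lemma det_eq_0_iff:
  fixes J :: "'a::field ^ 'n ^ 'n"
  shows "det J = 0 \<longleftrightarrow> (\<exists>x. x \<noteq> 0 \<and> x v* J = 0)"
proof -
  have "det J \<noteq> 0 \<longleftrightarrow> invertible (transpose J)"
    by (simp add: invertible_det_nz)
  also have "\<dots> \<longleftrightarrow> (\<forall>x. x v* J = 0 \<longrightarrow> x = 0)"
    by (simp add: invertible_left_inverse matrix_left_invertible_ker)
  finally show ?thesis by blast
qed

lemma order_eqI:
  fixes p :: "'a::field_char_0 poly"
  assumes "\<And>j. j < n \<Longrightarrow> poly ((pderiv ^^ j) p) t = 0" "poly ((pderiv ^^ n) p) t \<noteq> 0"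
  shows "p \<noteq> 0 \<and> order t p = n"
  using assms
proof (induction n arbitrary: p)
  case 0
  then show ?case by (auto intro: order_0I)
next
  case (Suc n)
  have shift: "(pderiv ^^ Suc j) p = (pderiv ^^ j) (pderiv p)" for j
    by (simp only: funpow_Suc_right o_apply)
  have "pderiv p \<noteq> 0 \<and> order t (pderiv p) = n"
    using Suc.prems unfolding shift[symmetric] by (intro Suc.IH) (auto simp only: shift[symmetric] Suc_less_eq)
  moreover have "poly p t = 0" using Suc.prems(1)[of 0] by simp
  moreover from calculation have "p \<noteq> 0" by auto
  ultimately show ?case using order_pderiv[of p t] by simp
qed

lemma poly_pderiv_funpow_sum:
  "poly ((pderiv ^^ j) (\<Sum>k\<in>S. smult (c k) (f k))) t = (\<Sum>k\<in>S. c k * poly ((pderiv ^^ j) (f k)) t)"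
  for f :: "'b \<Rightarrow> 'a::field_char_0 poly"
proof -
  have "(pderiv ^^ j) (\<Sum>k\<in>S. smult (c k) (f k)) = (\<Sum>k\<in>S. smult (c k) ((pderiv ^^ j) (f k)))"
    by (induction j) (simp_all add: poly_eq_iff coeff_pderiv coeff_sum sum_distrib_left mult_ac)
  then show ?thesis by (simp add: poly_sum)
qed

text \<open>In coordinates dual to \<open>D 0\<close>, \<open>D b\<close>, \<open>D c\<close>, the
  second one kills every \<open>D j\<close> with j < b and the third every \<open>D j\<close> with j
  < c, because the intermediate derivatives lie in the span of the earlier chosen ones. Taylor's
  criterion then gives the orders 0, b, c.\<close>

lemma has_ramification_sequence_finite:
  fixes f :: "3 \<Rightarrow> complex poly" and t :: complex
  defines "D \<equiv> \<lambda>j. \<chi> k. poly ((pderiv ^^ j) (f k)) t"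
  assumes deg: "\<And>k. degree (f k) \<le> d"
    and "0 < b" "b < c"
    and det: "det (vector [D 0, D b, D c]) \<noteq> 0"
    and dep1: "\<And>j. 0 < j \<Longrightarrow> j < b \<Longrightarrow> \<exists>x. D j = x *s D 0"
    and dep2: "\<And>j. b < j \<Longrightarrow> j < c \<Longrightarrow> \<exists>x y. D j = x *s D 0 + y *s D b"
  shows "has_ramification_sequence (\<chi> k. homogenize d (f k)) (line_point t) (0, b, c)"
proof -
  let ?J = "vector [D 0, D b, D c] :: complex ^ 3 ^ 3"
  obtain A :: "complex ^ 3 ^ 3" where A: "invertible A"
    "\<And>i j. (\<Sum>k\<in>UNIV. A $ i $ k * ?J $ j $ k) = (if i = j then 1 else 0)"
    using dual_matrix[OF det] by blast
  define p where "p i = (\<Sum>k\<in>UNIV. smult (A $ i $ k) (f k))" for i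
  define e where "e i x = (\<Sum>k\<in>UNIV. A $ i $ k * x $ k)" for i and x :: "complex ^ 3"
  have p: "poly ((pderiv ^^ j) (p i)) t = e i (D j)" for i j
    unfolding p_def poly_pderiv_funpow_sum by (simp add: e_def D_def)
  have e0: "e i (D 0) = (if i = 1 then 1 else 0)" for i
    using A(2)[of i 1] by (simp add: e_def)
  have eb: "e i (D b) = (if i = 2 then 1 else 0)" for i
    using A(2)[of i 2] by (simp add: e_def)
  have ec: "e i (D c) = (if i = 3 then 1 else 0)" for i
    using A(2)[of i 3] by (simp add: e_def)
  have lin: "e i (x *s u + y *s v) = x * e i u + y * e i v" "e i (x *s u) = x * e i u" for i x y u v
    by (simp_all add: e_def sum_distrib_left sum.distrib algebra_simps)
  have deg_p: "degree (p i) \<le> d" for i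
    unfolding p_def by (intro degree_sum_le) (auto intro: deg)
  have "p 1 \<noteq> 0 \<and> order t (p 1) = 0"
    using p[of 0 1] by (intro order_eqI) (simp_all add: e0)
  moreover have "p 2 \<noteq> 0 \<and> order t (p 2) = b"
  proof (rule order_eqI)
    fix j assume "j < b"
    then show "poly ((pderiv ^^ j) (p 2)) t = 0"
      using dep1[of j] unfolding p by (cases "j = 0") (auto simp: e0 lin)
  qed (simp add: p eb)
  moreover have "p 3 \<noteq> 0 \<and> order t (p 3) = c"
  proof (rule order_eqI)
    fix j assume "j < c"
    then consider "j = 0" | "0 < j" "j < b" | "j = b" | "b < j" by linarith
    then show "poly ((pderiv ^^ j) (p 3)) t = 0"
      unfolding p using dep1[of j] dep2[of j] \<open>j < c\<close>
      by cases (auto simp: e0 eb lin)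
  qed (simp add: p ec)
  ultimately have "vanishes_to_order (vector [t, 1]) 0 (homogenize d (p 1))"
    "vanishes_to_order (vector [t, 1]) b (homogenize d (p 2))"
    "vanishes_to_order (vector [t, 1]) c (homogenize d (p 3))"
    using deg_p by (auto intro!: vanishes_to_order_finite)
  moreover have "vector [t, 1] \<noteq> (0 :: complex ^ 2)"
    by (simp add: vector_2_eq_iff)
  ultimately show ?thesis
    unfolding has_ramification_sequence_def prod.case lin_comb_homogenize
    using A(1) \<open>0 < b\<close> \<open>b < c\<close> by (auto simp: p_def line_point_def)
qed

text \<open>In the local parameter 1/t the expansion at infinity consists of the coefficients read
  from the top, and the dual coordinates work as at a finite point.\<close>

lemma has_ramification_sequence_infinity:
  fixes f :: "3 \<Rightarrow> complex poly"
  defines "C \<equiv> \<lambda>j. \<chi> k. coeff (f k) j"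
  assumes det: "det (vector [C (Suc (Suc d)), C (Suc d), C d]) \<noteq> 0"
  shows "has_ramification_sequence (\<chi> k. homogenize (Suc (Suc d)) (f k)) line_infinity (0, 1, 2)"
proof -
  let ?J = "vector [C (Suc (Suc d)), C (Suc d), C d] :: complex ^ 3 ^ 3"
  obtain A :: "complex ^ 3 ^ 3" where A: "invertible A"
    "\<And>i j. (\<Sum>k\<in>UNIV. A $ i $ k * ?J $ j $ k) = (if i = j then 1 else 0)"
    using dual_matrix[OF det] by blast
  define p where "p i = (\<Sum>k\<in>UNIV. smult (A $ i $ k) (f k))" for i
  have p: "coeff (p i) (Suc (Suc d)) = (if i = 1 then 1 else 0)" "coeff (p i) (Suc d) = (if i = 2 then 1 else 0)"
    "coeff (p i) d = (if i = 3 then 1 else 0)" for i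
    using A(2)[of i 1] A(2)[of i 2] A(2)[of i 3] by (simp_all add: p_def C_def coeff_sum)
  have "vanishes_to_order (vector [1, 0]) 0 (homogenize (Suc (Suc d)) (p 1))"
    "vanishes_to_order (vector [1, 0]) 1 (homogenize (Suc (Suc d)) (p 2))"
    "vanishes_to_order (vector [1, 0]) 2 (homogenize (Suc (Suc d)) (p 3))"
    by (auto intro!: vanishes_to_order_infinity simp: p numeral_2_eq_2 less_Suc_eq)
  moreover have "vector [1, 0] \<noteq> (0 :: complex ^ 2)"
    by (simp add: vector_2_eq_iff)
  ultimately show ?thesis
    unfolding has_ramification_sequence_def prod.case lin_comb_homogenize
    using A(1) by (auto simp: p_def line_infinity_def)
qed

definition wronskian :: "(3 \<Rightarrow> 'a::idom poly) \<Rightarrow> 'a poly" where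
  "wronskian f = det (vector [\<chi> k. f k, \<chi> k. pderiv (f k), \<chi> k. pderiv (pderiv (f k))])"

lemma ramification_at_wronskian_nonroot:
  fixes f :: "3 \<Rightarrow> complex poly"
  assumes "\<And>k. degree (f k) \<le> d" "poly (wronskian f) t \<noteq> 0"
  shows "has_ramification_sequence (\<chi> k. homogenize d (f k)) (line_point t) (0, 1, 2)"
proof (rule has_ramification_sequence_finite)
  show "det (vector [\<chi> k. poly ((pderiv ^^ 0) (f k)) t, \<chi> k. poly ((pderiv ^^ 1) (f k)) t,
      \<chi> k. poly ((pderiv ^^ 2) (f k)) t] :: complex ^ 3 ^ 3) \<noteq> 0"
    using assms(2) by (simp add: wronskian_def det_3 numeral_2_eq_2)
qed (use assms in auto)

lemma ramification_at_wronskian_simple_root: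
  fixes f :: "3 \<Rightarrow> complex poly"
  assumes "\<And>k. degree (f k) \<le> d" "poly (wronskian f) t = 0" "poly (pderiv (wronskian f)) t \<noteq> 0"
  shows "has_ramification_sequence (\<chi> k. homogenize d (f k)) (line_point t) (0, 1, 3)"
proof (rule has_ramification_sequence_finite)
  define D where "D j = (\<chi> k. poly ((pderiv ^^ j) (f k)) t)" for j
  have "poly (wronskian f) t = det (vector [D 0, D 1, D 2])"
    by (simp add: wronskian_def D_def det_3 numeral_2_eq_2)
  then obtain x :: "complex ^ 3" where x: "x \<noteq> 0" "x $ 1 *s D 0 + (x $ 2 *s D 1 + x $ 3 *s D 2) = 0"
    using assms(2) by (auto simp: det_eq_0_iff vector_matrix_mult_3)
  \<comment> \<open>When a determinant is differentiated row by row, every term except the one for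
    the last row has two equal rows here.\<close>
  have "poly (pderiv (wronskian f)) t = det (vector [D 0, D 1, D 3])"
    by (simp add: wronskian_def D_def det_3 numeral_2_eq_2 numeral_3_eq_3 pderiv_diff pderiv_add pderiv_mult algebra_simps)
  then have det: "det (vector [D 0, D 1, D 3]) \<noteq> 0"
    using assms(3) by simp
  then show "det (vector [\<chi> k. poly ((pderiv ^^ 0) (f k)) t, \<chi> k. poly ((pderiv ^^ 1) (f k)) t,
      \<chi> k. poly ((pderiv ^^ 3) (f k)) t] :: complex ^ 3 ^ 3) \<noteq> 0"
    by (simp add: D_def)
  \<comment> \<open>Otherwise \<open>D 0\<close> and \<open>D 1\<close> would already be dependent
    and the derivative of the Wronskian would vanish as well. Hence the relation can be solved for
    \<open>D 2\<close>.\<close>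
  have "x $ 3 \<noteq> 0"
  proof
    assume "x $ 3 = 0"
    with x have "x v* vector [D 0, D 1, D 3] = 0"
      by (simp add: vector_matrix_mult_3)
    with x(1) det show False by (auto simp: det_eq_0_iff)
  qed
  moreover have "x $ 1 * D 0 $ k + (x $ 2 * D 1 $ k + x $ 3 * D 2 $ k) = 0" for k
    using x(2) by (simp add: vec_eq_iff)
  moreover have "d = (- a / c) * u + (- b / c) * v" if "a * u + (b * v + c * d) = 0" "c \<noteq> 0"
    for a b c d u v :: complex
  proof -
    have "d * c = - a * u - b * v" using that(1) by algebra
    then have "d = (- a * u - b * v) / c" using that(2) by (simp add: nonzero_eq_divide_eq)
    then show ?thesis by (simp add: diff_divide_distrib)
  qed
  ultimately have "D 2 $ k = (- x $ 1 / x $ 3) * D 0 $ k + (- x $ 2 / x $ 3) * D 1 $ k" for k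
    by blast
  then have "D 2 = (- x $ 1 / x $ 3) *s D 0 + (- x $ 2 / x $ 3) *s D 1"
    by (simp add: vec_eq_iff)
  moreover fix j :: nat
  assume "1 < j" "j < 3"
  then have "j = 2" by simp
  ultimately show "\<exists>x y. (\<chi> k. poly ((pderiv ^^ j) (f k)) t) =
      x *s (\<chi> k. poly ((pderiv ^^ 0) (f k)) t) + y *s (\<chi> k. poly ((pderiv ^^ 1) (f k)) t)"
    unfolding D_def by blast
qed (use assms in auto)

lemma ramification_at_wronskian_double_root:
  fixes f :: "3 \<Rightarrow> complex poly"
  assumes "\<And>k. degree (f k) \<le> d" "\<And>k. poly (pderiv (f k)) t = x * poly (f k) t"
    and "poly (pderiv (pderiv (wronskian f))) t \<noteq> 0"
  shows "has_ramification_sequence (\<chi> k. homogenize d (f k)) (line_point t) (0, 2, 3)"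
proof (rule has_ramification_sequence_finite)
  \<comment> \<open>The second derivative is det(f, f'', f''') + det(f, f', f''''), and the last
    determinant is zero at \<open>t\<close> because f' is a multiple of f there.\<close>
  have "poly (pderiv (pderiv (wronskian f))) t = det (vector [\<chi> k. poly ((pderiv ^^ 0) (f k)) t, \<chi> k. poly ((pderiv ^^ 2) (f k)) t,
      \<chi> k. poly ((pderiv ^^ 3) (f k)) t] :: complex ^ 3 ^ 3)"
    by (simp add: wronskian_def det_3 numeral_2_eq_2 numeral_3_eq_3 pderiv_diff pderiv_add pderiv_mult assms(2) algebra_simps)
  then show "det (vector [\<chi> k. poly ((pderiv ^^ 0) (f k)) t, \<chi> k. poly ((pderiv ^^ 2) (f k)) t,
      \<chi> k. poly ((pderiv ^^ 3) (f k)) t] :: complex ^ 3 ^ 3) \<noteq> 0"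
    using assms(3) by simp
  fix j :: nat
  assume "0 < j" "j < 2"
  then have "j = 1" by simp
  then show "\<exists>x. (\<chi> k. poly ((pderiv ^^ j) (f k)) t) = x *s (\<chi> k. poly ((pderiv ^^ 0) (f k)) t)"
    by (auto simp: vec_eq_iff assms(2))
qed (use assms in auto)

text \<open>When the degree does not exceed the number of sign changes, the intermediate value
  theorem leaves no room for nonreal or multiple roots. For n = 0 the product is empty and
  \<open>p\<close> is a constant, possibly zero.\<close>

lemma sign_changes_imp_simple_roots:
  fixes p :: "real poly" and x :: "nat \<Rightarrow> real"
  assumes mono: "\<And>i. i < n \<Longrightarrow> x i < x (Suc i)"
    and sign: "\<And>i. i < n \<Longrightarrow> poly p (x i) * poly p (x (Suc i)) < 0"
    and "degree p \<le> n"
  obtains R where "finite R" "card R = n" "p = smult (coeff p n) (\<Prod>r\<in>R. [:- r, 1:])"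
proof -
  have "\<forall>i\<in>{..<n}. \<exists>r. x i < r \<and> r < x (Suc i) \<and> poly p r = 0"
    using poly_IVT mono sign by (metis lessThan_iff)
  then obtain r where r: "x i < r i" "r i < x (Suc i)" "poly p (r i) = 0" if "i < n" for i
    by (metis lessThan_iff)
  have x_le: "x i \<le> x j" if "i \<le> j" "j \<le> n" for i j
    using that
  proof (induction j rule: dec_induct)
    case (step m)
    then show ?case using mono[of m] by simp
  qed simp
  have "r i < r j" if "i < j" "j < n" for i j
    using r[of i] r[of j] x_le[of "Suc i" j] that by linarith
  then have "inj_on r {..<n}"
    by (metis inj_onI lessThan_iff less_irrefl nat_neq_iff)
  then have card: "card (r ` {..<n}) = n"
    by (simp add: card_image)
  let ?q = "\<Prod>r\<in>r ` {..<n}. [:- r, 1:]"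
  have deg: "degree ?q = n"
    by (subst degree_prod_eq_sum_degree) (auto simp: card)
  have "lead_coeff ?q = 1"
    by (simp add: lead_coeff_prod)
  then have "coeff ?q n = 1" by (simp add: deg)
  then have "p = smult (coeff p n) ?q"
  proof (intro poly_eqI_degree_lead_coeff[where A = "r ` {..<n}" and n = n])
    fix z assume "z \<in> r ` {..<n}"
    then show "poly p z = poly (smult (coeff p n) ?q) z"
      using r by (auto simp: poly_prod)
  qed (use assms card deg in \<open>auto intro: order_trans[OF degree_smult_le]\<close>)
  with card show thesis using that by blast
qed

subsection \<open>Real polynomials over the complex numbers\<close>

abbreviation cpoly :: "real poly \<Rightarrow> complex poly" where
  "cpoly \<equiv> map_poly complex_of_real"

lemma cpoly_add: "cpoly (p + q) = cpoly p + cpoly q"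
  and cpoly_diff: "cpoly (p - q) = cpoly p - cpoly q"
  and cpoly_smult: "cpoly (smult a p) = smult (complex_of_real a) (cpoly p)"
  and cpoly_mult: "cpoly (p * q) = cpoly p * cpoly q"
  and cpoly_pderiv: "cpoly (pderiv p) = pderiv (cpoly p)"
  by (simp_all add: poly_eq_iff coeff_map_poly coeff_mult coeff_pderiv)

lemma cpoly_prod: "cpoly (\<Prod>x\<in>S. g x) = (\<Prod>x\<in>S. cpoly (g x))"
  by (induction S rule: infinite_finite_induct) (simp_all add: cpoly_mult)

lemma poly_cpoly_of_real: "poly (cpoly p) (of_real x) = of_real (poly p x)"
  by (induction p) (simp_all add: map_poly_pCons)

lemma cnj_poly_cpoly: "cnj (poly (cpoly p) z) = poly (cpoly p) (cnj z)"
  by (induction p) (simp_all add: map_poly_pCons)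

lemma wronskian_cpoly: "wronskian (\<lambda>k. cpoly (f k)) = cpoly (wronskian f)"
  by (simp add: wronskian_def det_3 cpoly_add cpoly_diff cpoly_mult flip: cpoly_pderiv)

subsection \<open>Quartics as Cremona images of conics\<close>

lemma numeral_mod_3: "(4 :: 3) = 1" "(5 :: 3) = 2"
  by simp_all

text \<open>Cyclic indices let one argument at an arbitrary vertex \<open>k\<close>, with
  \<open>k + 1\<close> and \<open>k + 2\<close> for the others, cover all three vertices.\<close>

lemma index_3:
  fixes k :: 3
  shows "k + 1 + 1 = k + 2" "k + 1 + 2 = k" "k + 2 + 1 = k" "k + 2 + 2 = k + 1"
    "k + 1 \<noteq> k" "k + 2 \<noteq> k" "k + 1 \<noteq> k + 2"
  using exhaust_3[of k] by auto

lemma all_3: "(\<forall>j. P j) \<longleftrightarrow> P k \<and> P (k + 1) \<and> P (k + 2)" for k :: 3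
  using exhaust_3[of k] by (auto simp: forall_3 numeral_mod_3)

lemma card_3: "card {k :: 3. P k} = of_bool (P 1) + of_bool (P 2) + of_bool (P 3)"
proof -
  have "card {k :: 3. P k} = (\<Sum>k\<in>UNIV. of_bool (P k))"
    by (simp add: sum_of_bool_eq)
  then show ?thesis by (simp add: sum_3)
qed

text \<open>The Cremona transformation \<open>[x, y, z] \<mapsto> [yz, zx, xy]\<close> is an involution off the coordinate triangle.\<close>

lemma cremona_inj:
  fixes X Y :: "'a::field ^ 3"
  assumes eq: "\<And>k. X $ (k + 1) * X $ (k + 2) = c * (Y $ (k + 1) * Y $ (k + 2))"
    and nz: "\<And>k. X $ k \<noteq> 0" "\<And>k. Y $ k \<noteq> 0"
  obtains m where "X = m *s Y"
proof -
  have ratio: "X $ (k + 1) * Y $ k = X $ k * Y $ (k + 1)" for k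
  proof -
    have 1: "X $ (k + 2) * X $ k = c * (Y $ (k + 2) * Y $ k)" "X $ (k + 1) * X $ (k + 2) = c * (Y $ (k + 1) * Y $ (k + 2))"
      using eq[of "k + 1"] eq[of k] by (simp_all add: index_3)
    have "(X $ (k + 2) * X $ k) * (c * (Y $ (k + 1) * Y $ (k + 2))) = (X $ (k + 1) * X $ (k + 2)) * (c * (Y $ (k + 2) * Y $ k))"
      unfolding 1 by (simp only: mult_ac)
    moreover have "c \<noteq> 0" using 1(1) nz by auto
    ultimately show ?thesis using nz[of "k + 2"] by auto
  qed
  have "X = (X $ 1 / Y $ 1) *s Y"
    using ratio[of 1] ratio[of 3] nz by (simp add: vec_eq_iff forall_3 numeral_mod_3 field_simps)
  with that show thesis .
qed

definition realizable :: "nat \<Rightarrow> nat \<Rightarrow> nat \<Rightarrow> nat \<Rightarrow> bool" where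
  "realizable \<kappa> \<iota> \<eta> \<delta> \<longleftrightarrow> (\<exists>\<phi>.
    maximally_inflected_quartic \<phi> \<and>
    has_exactly \<kappa> {s. cusp \<phi> s} \<and>
    has_exactly \<iota> {s. flex \<phi> s} \<and>
    has_exactly \<eta> {P. real_node \<phi> P} \<and>
    has_exactly \<delta> {P. solitary_point \<phi> P})"

lemma coeff_pCons_numeral: "coeff (pCons a p) (numeral n) = coeff p (pred_numeral n)"
  by (simp add: numeral_eq_Suc)

lemma ex_3: "(\<exists>k :: 3. P k) \<longleftrightarrow> P 1 \<or> P 2 \<or> P 3"
  using forall_3[of "\<lambda>k. \<not> P k"] by blast

text \<open>The rows of \<open>M\<close> are the coefficients of the quadratics, in increasing order.  Indices of type \<open>3\<close>
  are added modulo 3, so \<open>k + 1\<close> and \<open>k + 2\<close> are the other two.  The last assumption says that the resultants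
  of the quadratics do not vanish, and \<open>lead_nonzero\<close> keeps their roots away from infinity.\<close>

locale cremona_quartic =
  fixes M :: "real ^ 3 ^ 3"
  assumes det_nonzero: "det M \<noteq> 0"
    and lead_nonzero: "\<And>k. M $ k $ 3 \<noteq> 0"
    and resultant_nonzero: "\<And>k. (M $ k $ 3 * M $ (k + 1) $ 1 - M $ k $ 1 * M $ (k + 1) $ 3)\<^sup>2 \<noteq>
      (M $ k $ 3 * M $ (k + 1) $ 2 - M $ k $ 2 * M $ (k + 1) $ 3) *
      (M $ k $ 2 * M $ (k + 1) $ 1 - M $ k $ 1 * M $ (k + 1) $ 2)"
begin

definition q :: "3 \<Rightarrow> real poly" where
  "q k = [:M $ k $ 1, M $ k $ 2, M $ k $ 3:]"

definition disc :: "3 \<Rightarrow> real" where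
  "disc k = (M $ k $ 2)\<^sup>2 - 4 * M $ k $ 1 * M $ k $ 3"

definition f :: "3 \<Rightarrow> real poly" where
  "f k = q (k + 1) * q (k + 2)"

definition \<phi> :: "(complex poly poly) ^ 3" where
  "\<phi> = (\<chi> k. homogenize 4 (cpoly (f k)))"

text \<open>The point of the conic at the parameter [z, 1]; \<open>F\<close> is its Cremona image on
  the quartic and \<open>dF\<close> the velocity of \<open>F\<close>.\<close>

definition Q :: "complex \<Rightarrow> complex ^ 3" where
  "Q z = (\<chi> k. poly (cpoly (q k)) z)"

definition F :: "complex \<Rightarrow> complex ^ 3" where
  "F z = (\<chi> k. poly (cpoly (f k)) z)"

definition dF :: "complex \<Rightarrow> complex ^ 3" where
  "dF z = (\<chi> k. poly (pderiv (cpoly (f k))) z)"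

lemma degree_f: "degree (cpoly (f k)) \<le> 4"
proof -
  have "degree (f k) \<le> degree (q (k + 1)) + degree (q (k + 2))"
    unfolding f_def by (rule degree_mult_le)
  moreover have "degree (q k) \<le> 2" for k by (simp add: q_def)
  then have "degree (q (k + 1)) + degree (q (k + 2)) \<le> 2 + 2" by (intro add_mono)
  ultimately show ?thesis
    by (intro degree_le) (simp add: coeff_map_poly coeff_eq_0)
qed

lemma F_nth: "F z $ k = Q z $ (k + 1) * Q z $ (k + 2)"
  by (simp add: F_def Q_def f_def cpoly_mult)

lemma dF_nth: "dF z $ k = Q z $ (k + 1) * poly (pderiv (cpoly (q (k + 2)))) z
    + Q z $ (k + 2) * poly (pderiv (cpoly (q (k + 1)))) z"
  by (simp add: dF_def Q_def f_def cpoly_mult pderiv_mult algebra_simps)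

lemma curve_point_finite: "curve_point \<phi> (line_point z) = vec.span {F z}"
  unfolding \<phi>_def F_def using degree_f by (rule curve_point_line_point)

lemma branch_tangent_finite: "branch_tangent \<phi> (line_point z) = vec.span {F z, dF z}"
  unfolding \<phi>_def F_def dF_def
  using branch_tangent_line_point[of "\<lambda>k. cpoly (f k)" 3 z] degree_f by simp

section \<open>The conic, and where the quartic is injective\<close>

lemma Q_nth: "Q z $ k = of_real (M $ k $ 1) + z * (of_real (M $ k $ 2) + z * of_real (M $ k $ 3))"
  by (simp add: Q_def q_def map_poly_pCons)

text \<open>The conic is the image of the standard conic [1, z, z^2] under \<open>M\<close>, so
  invertibility of \<open>M\<close> makes its parametrisation injective.\<close>

lemma Q_eq_matrix: "Q z = (\<chi> i j. of_real (M $ i $ j)) *v vector [1, z, z\<^sup>2]"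
  by (simp add: vec_eq_iff Q_nth matrix_vector_mult_def sum_3 power2_eq_square algebra_simps)

lemma complex_matrix_inj:
  assumes "(\<chi> i j. complex_of_real (M $ i $ j)) *v x = (\<chi> i j. of_real (M $ i $ j)) *v y"
  shows "x = y"
proof -
  have "det (\<chi> i j. complex_of_real (M $ i $ j)) = of_real (det M)"
    by (simp add: det_3)
  then have "invertible (\<chi> i j. complex_of_real (M $ i $ j))"
    using det_nonzero by (simp add: invertible_det_nz)
  then have "inj ((*v) (\<chi> i j. complex_of_real (M $ i $ j)))"
    by (simp add: invertible_left_inverse matrix_left_invertible_injective)
  with assms show ?thesis by (simp add: inj_eq)
qed

lemma Q_inj:
  assumes "Q z = c *s Q w"
  shows "z = w"
proof -
  have "vector [1, z, z\<^sup>2] = (c *s vector [1, w, w\<^sup>2] :: complex ^ 3)"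
    by (rule complex_matrix_inj) (use assms in \<open>simp add: Q_eq_matrix vector_scalar_commute\<close>)
  then show ?thesis by (simp add: vec_eq_iff forall_3)
qed

lemma Q_zero_next:
  assumes "Q z $ k = 0"
  shows "Q z $ (k + 1) \<noteq> 0"
proof
  assume "Q z $ (k + 1) = 0"
  define a b c a' b' c' where abc: "a = complex_of_real (M $ k $ 1)" "b = complex_of_real (M $ k $ 2)"
    "c = complex_of_real (M $ k $ 3)" "a' = complex_of_real (M $ (k + 1) $ 1)"
    "b' = complex_of_real (M $ (k + 1) $ 2)" "c' = complex_of_real (M $ (k + 1) $ 3)"
  have 1: "a + z * (b + z * c) = 0" and 2: "a' + z * (b' + z * c') = 0"
    using assms \<open>Q z $ (k + 1) = 0\<close> by (simp_all add: Q_nth abc)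
  have "(c * a' - a * c')\<^sup>2 = (c * b' - b * c') * (b * a' - a * b')"
  \<comment> \<open>Cancelling the leading terms of the two quadratics, and then the constant terms,
    gives two linear relations in z whose elimination is the vanishing of the resultant. The second
    relation has to be divided by z; for z = 0 both constant terms vanish and so do both
    sides.\<close>
  proof (cases "z = 0")
    case False
    have "(c * b' - b * c') * z + (c * a' - a * c') = 0"
      using 1 2 by algebra
    moreover have "z * ((b * a' - a * b') + (c * a' - a * c') * z) = 0"
      using 1 2 by algebra
    then have "(b * a' - a * b') + (c * a' - a * c') * z = 0"
      using False by simp
    ultimately show ?thesis by algebra
  qed (use 1 2 in simp)
  then have "of_real ((M $ k $ 3 * M $ (k + 1) $ 1 - M $ k $ 1 * M $ (k + 1) $ 3)\<^sup>2) = complex_of_real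
      ((M $ k $ 3 * M $ (k + 1) $ 2 - M $ k $ 2 * M $ (k + 1) $ 3) *
      (M $ k $ 2 * M $ (k + 1) $ 1 - M $ k $ 1 * M $ (k + 1) $ 2))"
    by (simp add: abc)
  with resultant_nonzero[of k] show False by (simp only: of_real_eq_iff)
qed

lemma Q_zero_others:
  assumes "Q z $ k = 0"
  shows "Q z $ (k + 1) \<noteq> 0" "Q z $ (k + 2) \<noteq> 0"
  using Q_zero_next[OF assms] Q_zero_next[of z "k + 2"] assms by (auto simp: index_3)

text \<open>The Cremona map contracts a side of the triangle to the opposite vertex: only coordinate
  \<open>k\<close> omits the factor \<open>q k\<close>.\<close>

lemma F_at_root:
  assumes "Q z $ k = 0"
  shows "F z = (Q z $ (k + 1) * Q z $ (k + 2)) *s axis k 1"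
  using assms by (simp add: vec_eq_iff all_3[of _ k] F_nth axis_def index_3)

lemma span_F_at_root: "Q z $ k = 0 \<Longrightarrow> vec.span {F z} = vec.span {axis k 1}"
  using Q_zero_others[of z k] by (simp add: F_at_root span_scale)

lemma F_nonzero: "F z \<noteq> 0"
proof
  assume "F z = 0"
  then have "Q z $ (k + 1) * Q z $ (k + 2) = 0" for k by (simp flip: F_nth)
  then show False
    using Q_zero_others by (metis index_3(3) mult_eq_0_iff)
qed

lemma span_F_eq_axis_iff: "vec.span {F z} = vec.span {axis k 1} \<longleftrightarrow> Q z $ k = 0"
proof
  assume "vec.span {F z} = vec.span {axis k 1}"
  then obtain c where c: "c \<noteq> 0" "F z = c *s axis k 1"
    using F_nonzero by (rule span_singleton_eqD)
  then have "F z $ k \<noteq> 0" "F z $ (k + 1) = 0" by (simp_all add: axis_def index_3)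
  then show "Q z $ k = 0" by (auto simp: F_nth index_3)
qed (rule span_F_at_root)

text \<open>If z were off the triangle, so would be w, and injectivity of the Cremona map and of the
  conic would give z = w. Otherwise the common image is a vertex, and only roots of the
  corresponding quadratic map there.\<close>

lemma F_proportional:
  assumes "F z = c *s F w" "c \<noteq> 0" "z \<noteq> w"
  obtains k where "Q z $ k = 0" "Q w $ k = 0"
proof -
  have "\<exists>k. Q z $ k = 0"
  proof (rule ccontr)
    assume "\<nexists>k. Q z $ k = 0"
    then have nz: "Q z $ k \<noteq> 0" for k by blast
    have eq: "Q z $ (k + 1) * Q z $ (k + 2) = c * (Q w $ (k + 1) * Q w $ (k + 2))" for k
      using assms(1) by (simp add: vec_eq_iff F_nth)
    then have "Q w $ (k + 1) \<noteq> 0" for k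
      using nz by (metis mult_eq_0_iff)
    then have "Q w $ k \<noteq> 0" for k
      by (metis index_3(3))
    with eq nz obtain m where "Q z = m *s Q w"
      by (rule cremona_inj)
    with assms(3) Q_inj show False by blast
  qed
  then obtain k where k: "Q z $ k = 0" ..
  moreover have "vec.span {F w} = vec.span {axis k 1}"
    using span_F_at_root[OF k] span_scale[OF assms(2), of "F w"] assms(1) by simp
  then have "Q w $ k = 0" by (simp add: span_F_eq_axis_iff)
  ultimately show thesis using that by blast
qed

text \<open>Nonzero leading coefficients put the image of infinity off the triangle, so the same
  injectivity argument applies with [0, 0, 1] in the role of [1, w, w^2].\<close>

lemma curve_point_infinity_unique:
  "curve_point \<phi> (line_point z) \<noteq> curve_point \<phi> line_infinity"
proof
  let ?L = "(\<chi> k. of_real (M $ k $ 3)) :: complex ^ 3"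
  have "coeff (cpoly (f k)) 4 = ?L $ (k + 1) * ?L $ (k + 2)" for k
    by (simp add: coeff_map_poly f_def q_def coeff_pCons numeral_eq_Suc)
  moreover assume "curve_point \<phi> (line_point z) = curve_point \<phi> line_infinity"
  ultimately have "vec.span {F z} = vec.span {\<chi> k. ?L $ (k + 1) * ?L $ (k + 2)}"
    using curve_point_finite[of z] by (simp add: \<phi>_def curve_point_line_infinity)
  then obtain c where c: "c \<noteq> 0" "F z = c *s (\<chi> k. ?L $ (k + 1) * ?L $ (k + 2))"
    using F_nonzero by (rule span_singleton_eqD)
  then have eq: "Q z $ (k + 1) * Q z $ (k + 2) = c * (?L $ (k + 1) * ?L $ (k + 2))" for k
    by (simp add: vec_eq_iff F_nth)
  have L: "?L $ k \<noteq> 0" for k using lead_nonzero by simp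
  have "Q z $ (k + 1) \<noteq> 0" for k
    using eq[of k] c(1) L[of "k + 1"] L[of "k + 2"] by auto
  then have "Q z $ k \<noteq> 0" for k
    by (metis index_3(3))
  with eq obtain m where m: "Q z = m *s ?L"
    using L by (rule cremona_inj)
  have L': "(\<chi> i j. of_real (M $ i $ j)) *v vector [0, 0, m] = m *s ?L"
    by (simp add: vec_eq_iff matrix_vector_mult_def sum_3)
  have "vector [1, z, z\<^sup>2] = (vector [0, 0, m] :: complex ^ 3)"
    by (rule complex_matrix_inj) (use m L' in \<open>simp add: Q_eq_matrix\<close>)
  then show False by (simp add: vec_eq_iff forall_3)
qed

section \<open>Roots of the quadratics and tangents at the vertices\<close>

lemma factor_q:
  obtains z w where "cpoly (q k) = smult (of_real (M $ k $ 3)) ([:- z, 1:] * [:- w, 1:])"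
    "disc k > 0 \<Longrightarrow> z \<in> \<real> \<and> w \<in> \<real>" "disc k < 0 \<Longrightarrow> w = cnj z" "disc k \<noteq> 0 \<longleftrightarrow> z \<noteq> w"
proof -
  define a b c d where abc: "a = complex_of_real (M $ k $ 1)" "b = complex_of_real (M $ k $ 2)"
    "c = complex_of_real (M $ k $ 3)" and d: "d = csqrt (of_real (disc k))"
  have d2: "d\<^sup>2 = b\<^sup>2 - 4 * a * c"
    by (simp add: d disc_def abc)
  have c: "c \<noteq> 0" using lead_nonzero[of k] by (simp add: abc)
  define z w where zw: "z = (- b + d) / (2 * c)" "w = (- b - d) / (2 * c)"
  have prod: "c * (z * w) = a"
  proof -
    have "c * (z * w) = (b\<^sup>2 - d\<^sup>2) / (4 * c)"
      using c by (simp add: zw field_simps power2_eq_square)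
    then show ?thesis using c by (simp add: d2)
  qed
  have "c * z + c * w = - b"
    using c by (simp add: zw field_simps)
  then have sum: "b = - (c * z) - c * w" by algebra
  show thesis
  proof (rule that)
    have "cpoly (q k) = [:a, b, c:]"
      by (simp add: q_def abc map_poly_pCons)
    also have "\<dots> = smult c ([:- z, 1:] * [:- w, 1:])"
      by (simp add: sum algebra_simps flip: prod)
    finally show "cpoly (q k) = smult (of_real (M $ k $ 3)) ([:- z, 1:] * [:- w, 1:])"
      by (simp only: abc)
    show "z \<in> \<real> \<and> w \<in> \<real>" if "disc k > 0"
    proof -
      have "d \<in> \<real>" using that by (simp add: d flip: of_real_sqrt)
      then show ?thesis by (simp add: zw abc)
    qed
    show "w = cnj z" if "disc k < 0"
    proof -
      have "cnj d = - d" using that by (simp add: d csqrt_of_real_nonpos)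
      then show ?thesis by (simp add: zw abc)
    qed
    show "disc k \<noteq> 0 \<longleftrightarrow> z \<noteq> w"
      using c by (simp add: zw field_simps d)
  qed
qed

lemma root_iff:
  assumes "cpoly (q k) = smult (of_real (M $ k $ 3)) ([:- z, 1:] * [:- w, 1:])"
  shows "Q x $ k = 0 \<longleftrightarrow> x = z \<or> x = w"
proof -
  have "Q x $ k = of_real (M $ k $ 3) * ((x - z) * (x - w))"
    by (simp only: Q_def vec_lambda_beta assms poly_smult poly_mult poly_pCons) simp
  then show ?thesis using lead_nonzero[of k] by simp
qed

lemma derivative_at_root:
  assumes "Q z $ k = 0" "Q w $ k = 0" "z \<noteq> w"
  shows "poly (pderiv (cpoly (q k))) z \<noteq> 0"
proof -
  obtain z' w' where zw: "cpoly (q k) = smult (of_real (M $ k $ 3)) ([:- z', 1:] * [:- w', 1:])"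
    using factor_q by blast
  have "(z = z' \<and> w = w') \<or> (z = w' \<and> w = z')"
    using assms by (auto simp: root_iff[OF zw])
  moreover have "poly (pderiv (smult c ([:- x, 1:] * [:- y, 1:]))) x = c * (x - y)"
    "poly (pderiv (smult c ([:- y, 1:] * [:- x, 1:]))) x = c * (x - y)" for c x y :: complex
    by (simp_all add: pderiv_smult pderiv_mult pderiv_pCons algebra_simps)
  ultimately have "poly (pderiv (cpoly (q k))) z = of_real (M $ k $ 3) * (z - w)"
    unfolding zw by metis
  then show ?thesis
    using lead_nonzero[of k] assms(3) by simp
qed

definition T :: "complex \<Rightarrow> (complex ^ 3) set" where
  "T z = vec.span {F z, dF z}"

lemma T_at_root: "Q z $ k = 0 \<Longrightarrow> T z = vec.span {axis k 1, dF z}"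
  unfolding T_def insert_is_Un[of "F z" "{dF z}"] insert_is_Un[of "axis k 1" "{dF z}"] vec.span_Un
  by (simp add: span_F_at_root)

text \<open>Modulo the vertex, the tangent direction is the point of the conic with its two
  remaining coordinates exchanged, times the derivative of \<open>q k\<close>.\<close>

lemma dF_at_root:
  assumes "Q z $ k = 0"
  shows "dF z $ (k + 1) = Q z $ (k + 2) * poly (pderiv (cpoly (q k))) z"
    "dF z $ (k + 2) = Q z $ (k + 1) * poly (pderiv (cpoly (q k))) z"
  using assms by (simp_all add: dF_nth index_3)

lemma dim_T:
  assumes "Q z $ k = 0" "poly (pderiv (cpoly (q k))) z \<noteq> 0"
  shows "vec.dim (T z) = 2"
proof -
  have "dF z $ (k + 1) \<noteq> 0"
    using assms Q_zero_others[of z k] by (simp add: dF_at_root)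
  then have "dF z \<notin> vec.span {axis k 1}"
    by (auto simp: vec.span_singleton axis_def index_3)
  moreover have "axis k 1 \<noteq> (0 :: complex ^ 3)" by simp
  ultimately have "vec.independent {dF z, axis k 1}" "dF z \<noteq> axis k 1"
    using vec.span_base[of "axis k 1" "{axis k 1 :: complex ^ 3}"] by (auto simp: vec.independent_insert)
  then show ?thesis
    using assms(1) vec.dim_span_eq_card_independent[of "{dF z, axis k 1}"]
    by (simp add: T_at_root insert_commute)
qed

text \<open>Equal tangents make the coordinates \<open>k + 1\<close> and \<open>k + 2\<close> of the
  two conic points proportional. Their coordinates \<open>k\<close> are zero, so the points agree,
  and the conic is injectively parametrised.\<close>

lemma T_inj:
  assumes "Q z $ k = 0" "Q w $ k = 0" "poly (pderiv (cpoly (q k))) z \<noteq> 0" "T z = T w"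
  shows "z = w"
proof -
  have "dF z \<in> vec.span {dF w, axis k 1}"
    using assms vec.span_base[of "dF z" "{axis k 1, dF z}"] by (simp add: T_at_root insert_commute)
  then obtain b a where "dF z - b *s dF w = a *s axis k 1"
    by (auto simp: vec.span_insert vec.span_singleton)
  then have "dF z $ j - b * dF w $ j = a * axis k 1 $ j" for j
    by (simp add: vec_eq_iff)
  from this[of "k + 1"] this[of "k + 2"] have
    "dF z $ (k + 1) = b * dF w $ (k + 1)" "dF z $ (k + 2) = b * dF w $ (k + 2)"
    by (simp_all add: axis_def index_3)
  moreover have "x = b * e / d * y" if "x * d = b * (y * e)" "d \<noteq> 0" for x y d e :: complex
    using that by (simp add: field_simps)
  ultimately have "Q z = (b * poly (pderiv (cpoly (q k))) w / poly (pderiv (cpoly (q k))) z) *s Q w"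
    using assms by (simp only: vec_eq_iff all_3[of _ k] dF_at_root vector_smult_component) auto
  then show ?thesis by (rule Q_inj)
qed

section \<open>Classification of the double points\<close>

lemma ordinary_double_point_iff:
  "ordinary_double_point \<phi> P T1 T2 \<longleftrightarrow>
    (\<exists>k z w. z \<noteq> w \<and> Q z $ k = 0 \<and> Q w $ k = 0 \<and> P = vec.span {axis k 1} \<and> T1 = T z \<and> T2 = T w)"
proof
  assume "ordinary_double_point \<phi> P T1 T2"
  then obtain s t where st: "s \<noteq> t" "{u \<in> proj_points. curve_point \<phi> u = P} = {s, t}"
    "T1 = branch_tangent \<phi> s" "T2 = branch_tangent \<phi> t"
    by (auto simp: ordinary_double_point_def)
  then have st': "s \<in> proj_points" "t \<in> proj_points" "curve_point \<phi> s = P" "curve_point \<phi> t = P"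
    by auto
  \<comment> \<open>If one parameter were infinity, the other would be a finite parameter with the
    same image.\<close>
  have "s \<noteq> line_infinity" "t \<noteq> line_infinity"
    using st(1) st' curve_point_infinity_unique unfolding proj_points_line by fastforce+
  then obtain z w where zw: "s = line_point z" "t = line_point w"
    using st' by (auto simp: proj_points_line)
  then have "vec.span {F z} = vec.span {F w}"
    using st' by (simp add: curve_point_finite)
  then obtain c where c: "c \<noteq> 0" "F z = c *s F w"
    using F_nonzero by (rule span_singleton_eqD)
  obtain k where "Q z $ k = 0" "Q w $ k = 0"
    using F_proportional[OF c(2,1)] zw st(1) by auto
  moreover have "z \<noteq> w" using zw st(1) by auto
  ultimately show "\<exists>k z w. z \<noteq> w \<and> Q z $ k = 0 \<and> Q w $ k = 0 \<and> P = vec.span {axis k 1} \<and> T1 = T z \<and> T2 = T w"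
    using zw st st' by (metis T_def branch_tangent_finite curve_point_finite span_F_at_root)
next
  assume "\<exists>k z w. z \<noteq> w \<and> Q z $ k = 0 \<and> Q w $ k = 0 \<and> P = vec.span {axis k 1} \<and> T1 = T z \<and> T2 = T w"
  then obtain k z w where *: "z \<noteq> w" "Q z $ k = 0" "Q w $ k = 0" "P = vec.span {axis k 1}" "T1 = T z" "T2 = T w"
    by blast
  have d: "poly (pderiv (cpoly (q k))) z \<noteq> 0" "poly (pderiv (cpoly (q k))) w \<noteq> 0"
    using derivative_at_root * by auto
  have inf: "curve_point \<phi> line_infinity \<noteq> P"
    using curve_point_infinity_unique[of z] * by (simp add: curve_point_finite span_F_at_root)
  have "curve_point \<phi> (line_point x) = P \<longleftrightarrow> x = z \<or> x = w" for x
  proof -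
    obtain z' w' where zw: "cpoly (q k) = smult (of_real (M $ k $ 3)) ([:- z', 1:] * [:- w', 1:])"
      using factor_q by blast
    show ?thesis
      using *(1-4) by (auto simp only: curve_point_finite span_F_eq_axis_iff root_iff[OF zw])
  qed
  then have fibre: "curve_point \<phi> (line_point x) = P \<longleftrightarrow> x \<in> {z, w}" for x by simp
  have "{u \<in> proj_points. curve_point \<phi> u = P} = line_point ` {x. curve_point \<phi> (line_point x) = P}"
    unfolding proj_points_line using inf by blast
  also have "\<dots> = {line_point z, line_point w}"
    unfolding fibre by blast
  finally have "{u \<in> proj_points. curve_point \<phi> u = P} = {line_point z, line_point w}" .
  moreover have "P \<in> proj_points"
    unfolding proj_points_def using *(4) by (auto intro!: exI[of _ "axis k 1"])
  moreover have "T z \<noteq> T w" using T_inj[of z k w] * d by blast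
  ultimately show "ordinary_double_point \<phi> P T1 T2"
    unfolding ordinary_double_point_def
    using * d dim_T by (intro conjI exI[of _ "line_point z"] exI[of _ "line_point w"])
      (auto simp: T_def branch_tangent_finite)
qed

lemma real_subspace_axis: "real_subspace (vec.span {axis k (1 :: complex)})"
  unfolding real_subspace_def by (rule exI[of _ "{axis k 1}"]) (simp add: axis_def)

lemma real_subspace_T: "z \<in> \<real> \<Longrightarrow> real_subspace (T z)"
  unfolding real_subspace_def T_def
  by (rule exI[of _ "{F z, dF z}"])
     (auto simp: F_def dF_def poly_cpoly_of_real elim!: Reals_cases simp flip: cpoly_pderiv)

lemma conj_subspace_T: "conj_subspace (T z) = T (cnj z)"
  by (simp add: T_def conj_subspace_span F_def dF_def cnj_poly_cpoly flip: cpoly_pderiv)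

lemma roots_of_disc:
  assumes "Q z $ k = 0" "Q w $ k = 0" "z \<noteq> w"
  shows "disc k > 0 \<and> z \<in> \<real> \<and> w \<in> \<real> \<or> disc k < 0 \<and> w = cnj z"
proof -
  obtain z' w' where zw: "cpoly (q k) = smult (of_real (M $ k $ 3)) ([:- z', 1:] * [:- w', 1:])"
    "disc k > 0 \<Longrightarrow> z' \<in> \<real> \<and> w' \<in> \<real>" "disc k < 0 \<Longrightarrow> w' = cnj z'" "disc k \<noteq> 0 \<longleftrightarrow> z' \<noteq> w'"
    using factor_q by blast
  have "(z = z' \<and> w = w') \<or> (z = w' \<and> w = z')"
    using assms by (auto simp: root_iff[OF zw(1)])
  with zw(2-4) assms(3) show ?thesis
    by (cases "disc k" "0 :: real" rule: linorder_cases) auto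
qed

lemma roots_exist:
  assumes "disc k \<noteq> 0"
  obtains z w where "Q z $ k = 0" "Q w $ k = 0" "z \<noteq> w"
proof -
  obtain z w where zw: "cpoly (q k) = smult (of_real (M $ k $ 3)) ([:- z, 1:] * [:- w, 1:])" "disc k \<noteq> 0 \<longleftrightarrow> z \<noteq> w"
    using factor_q by blast
  with assms show thesis using that[of z w] by (simp add: root_iff[OF zw(1)])
qed

text \<open>Distinctness of the tangents is kept because it excludes the wrong sign of the
  discriminant later: a real line is its own conjugate, so no pair of distinct tangents can be both
  real and conjugate.\<close>

lemma ordinary_double_point_cases:
  assumes "ordinary_double_point \<phi> P T1 T2"
  obtains k where "P = vec.span {axis k 1}" "T1 \<noteq> T2"
    "disc k > 0 \<and> real_subspace T1 \<and> real_subspace T2 \<or> disc k < 0 \<and> T2 = conj_subspace T1"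
proof -
  have "T1 \<noteq> T2" using assms by (auto simp: ordinary_double_point_def)
  moreover obtain k z w where *: "z \<noteq> w" "Q z $ k = 0" "Q w $ k = 0" "P = vec.span {axis k 1}" "T1 = T z" "T2 = T w"
    using assms by (auto simp: ordinary_double_point_iff)
  ultimately show thesis
    using roots_of_disc[OF *(2,3,1)] that[of k] by (auto simp: real_subspace_T conj_subspace_T)
qed

lemma real_nodes: "{P. real_node \<phi> P} = (\<lambda>k. vec.span {axis k 1}) ` {k. disc k > 0}"
proof (rule set_eqI, rule iffI)
  fix P assume "P \<in> {P. real_node \<phi> P}"
  then obtain T1 T2 where *: "ordinary_double_point \<phi> P T1 T2" "real_subspace T1"
    by (auto simp: real_node_def)
  from *(1) show "P \<in> (\<lambda>k. vec.span {axis k 1}) ` {k. disc k > 0}"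
    by (rule ordinary_double_point_cases) (use *(2) conj_subspace_real in auto)
next
  fix P :: "(complex ^ 3) set" assume "P \<in> (\<lambda>k. vec.span {axis k 1}) ` {k. disc k > 0}"
  then obtain k where k: "P = vec.span {axis k 1}" "disc k > 0" by auto
  then obtain z w where "Q z $ k = 0" "Q w $ k = 0" "z \<noteq> w"
    using roots_exist[of k] by auto
  with k roots_of_disc show "P \<in> {P. real_node \<phi> P}"
    unfolding mem_Collect_eq real_node_def ordinary_double_point_iff
    by (metis real_subspace_axis real_subspace_T not_less_iff_gr_or_eq)
qed

lemma solitary_points: "{P. solitary_point \<phi> P} = (\<lambda>k. vec.span {axis k 1}) ` {k. disc k < 0}"
proof (rule set_eqI, rule iffI)
  fix P assume "P \<in> {P. solitary_point \<phi> P}"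
  then obtain T1 T2 where *: "ordinary_double_point \<phi> P T1 T2" "T2 = conj_subspace T1"
    by (auto simp: solitary_point_def)
  from *(1) show "P \<in> (\<lambda>k. vec.span {axis k 1}) ` {k. disc k < 0}"
    by (rule ordinary_double_point_cases) (use *(2) conj_subspace_real in auto)
next
  fix P :: "(complex ^ 3) set" assume "P \<in> (\<lambda>k. vec.span {axis k 1}) ` {k. disc k < 0}"
  then obtain k where k: "P = vec.span {axis k 1}" "disc k < 0" by auto
  then obtain z w where "Q z $ k = 0" "Q w $ k = 0" "z \<noteq> w"
    using roots_exist[of k] by auto
  with k roots_of_disc show "P \<in> {P. solitary_point \<phi> P}"
    unfolding mem_Collect_eq solitary_point_def ordinary_double_point_iff
    by (metis real_subspace_axis conj_subspace_T not_less_iff_gr_or_eq)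
qed

lemma has_exactly_axis_points:
  "has_exactly (card {k. P k}) ((\<lambda>k :: 3. vec.span {axis k (1 :: complex)}) ` {k. P k})"
proof -
  have "inj (\<lambda>k :: 3. vec.span {axis k (1 :: complex)})"
  proof (rule injI)
    fix k l :: 3
    assume "vec.span {axis k (1 :: complex)} = vec.span {axis l 1}"
    then obtain c where "c \<noteq> 0" "axis k (1 :: complex) = c *s axis l 1"
      by (rule span_singleton_eqD) simp
    then have "axis k (1 :: complex) $ k = c * axis l 1 $ k" by simp
    then show "k = l" by (auto simp: axis_def split: if_splits)
  qed
  then show ?thesis
    by (simp add: has_exactly_def card_image inj_on_subset)
qed

section \<open>Coprimality and linear independence of the components\<close>

lemma rational_plane_quartic: "rational_plane_quartic \<phi>"
  unfolding rational_plane_quartic_def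
proof (intro conjI allI impI)
  fix k show "binary_form 4 (\<phi> $ k)"
    by (simp add: \<phi>_def binary_form_homogenize)
next
  fix D assume D: "\<forall>k. D dvd \<phi> $ k"
  \<comment> \<open>There are no base points, infinity included; a nonunit common divisor would
    create one at any of its zeros.\<close>
  have no_zero: "\<exists>k. eval_form (\<phi> $ k) v \<noteq> 0" if "v \<noteq> 0" for v
    using that
  proof (cases rule: line_point_or_infinity)
    case (1 c t)
    have "\<exists>k. F t $ k \<noteq> 0" using F_nonzero[of t] by (auto simp: vec_eq_iff)
    with 1 show ?thesis
      by (simp add: \<phi>_def eval_homogenize_scale eval_homogenize_finite degree_f F_def)
  next
    case (2 c)
    have "coeff (cpoly (f k)) 4 \<noteq> 0" for k
      using lead_nonzero by (simp add: coeff_map_poly f_def q_def coeff_pCons numeral_eq_Suc)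
    with 2 show ?thesis
      by (simp add: \<phi>_def eval_homogenize_scale eval_homogenize_infinity)
  qed
  show "is_unit D"
  proof (rule ccontr)
    assume nonunit: "\<not> is_unit D"
    have "\<exists>k. eval_form (\<phi> $ k) (vector [1, 0]) \<noteq> 0"
      by (rule no_zero) (simp add: vector_2_eq_iff)
    then have "D \<noteq> 0" using D by (auto simp: eval_form_def)
    then obtain v where v: "v \<noteq> 0" "eval_form D v = 0"
      using nonunit nonunit_has_zero by blast
    have "eval_form (\<phi> $ k) v = 0" for k
    proof -
      obtain E where "\<phi> $ k = D * E" using D by (auto simp: dvd_def)
      then show ?thesis using v(2) by (simp add: eval_form_def)
    qed
    then show False using no_zero[OF v(1)] by blast
  qed
next
  fix c assume "lin_comb c \<phi> = 0"
  then have *: "homogenize 4 (\<Sum>k\<in>UNIV. smult (c $ k) (cpoly (f k))) = 0"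
    by (simp add: \<phi>_def lin_comb_homogenize)
  have "degree (\<Sum>k\<in>UNIV. smult (c $ k) (cpoly (f k))) \<le> 4"
    by (intro degree_sum_le) (auto intro: degree_f)
  from poly_homogenize_1[OF this] have "(\<Sum>k\<in>UNIV. smult (c $ k) (cpoly (f k))) = 0"
    by (simp add: *)
  then have "poly (\<Sum>k\<in>UNIV. smult (c $ k) (cpoly (f k))) z = 0" for z by simp
  then have sum: "(\<Sum>k\<in>UNIV. c $ k * F z $ k) = 0" for z
    by (simp add: poly_sum F_def)
  \<comment> \<open>At a root of \<open>q k\<close> all components of \<open>F\<close> except the
    one at \<open>k\<close> vanish, so evaluating the relation there isolates one
    coefficient.\<close>
  have "c $ k = 0" for k
  proof -
    obtain z w where zw: "cpoly (q k) = smult (of_real (M $ k $ 3)) ([:- z, 1:] * [:- w, 1:])"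
      using factor_q by blast
    have z: "Q z $ k = 0" using root_iff[OF zw] by blast
    have "(\<Sum>j\<in>UNIV. c $ j * F z $ j) = (\<Sum>j\<in>UNIV. if j = k then c $ k * F z $ k else 0)"
      by (intro sum.cong) (auto simp: F_at_root[OF z] axis_def)
    then have "c $ k * F z $ k = 0" using sum[of z] by simp
    then show ?thesis using Q_zero_others[OF z] by (simp add: F_nth)
  qed
  then show "c = 0" by (simp add: vec_eq_iff)
qed

lemma real_coefficients: "coeff (coeff (\<phi> $ k) j) i \<in> \<real>"
  by (simp add: \<phi>_def coeff_coeff_homogenize coeff_map_poly)

section \<open>Ramification of the quartic and the criterion for the examples\<close>

lemma pderiv_f_at_double_root:
  assumes "poly (q k) r = 0" "disc k = 0"
  shows "\<exists>x. \<forall>j. poly (pderiv (cpoly (f j))) (of_real r) = x * poly (cpoly (f j)) (of_real r)"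
proof -
  have Q: "Q (of_real r) $ k = 0"
    using assms(1) by (simp add: Q_def poly_cpoly_of_real)
  \<comment> \<open>With leading coefficient c, a quadratic satisfies q'^2 = disc + 4 c q; so a root
    is a root of q' too when the discriminant is zero.\<close>
  have "(poly (pderiv (q k)) r)\<^sup>2 = disc k + 4 * M $ k $ 3 * poly (q k) r"
    by (simp add: q_def disc_def pderiv_pCons power2_eq_square algebra_simps)
  then have "poly (pderiv (q k)) r = 0" using assms by simp
  then have d: "poly (pderiv (cpoly (q k))) (of_real r) = 0"
    by (simp add: poly_cpoly_of_real flip: cpoly_pderiv)
  let ?z = "complex_of_real r"
  \<comment> \<open>Point and velocity both lie on the axis \<open>k\<close> here, so they are
    proportional; this is what makes the branch a cusp.\<close>
  have "\<forall>j. dF ?z $ j = (dF ?z $ k / F ?z $ k) * F ?z $ j"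
    unfolding all_3[of _ k] using Q d Q_zero_others[OF Q]
    by (simp add: dF_at_root F_nth index_3)
  then have "\<exists>x. \<forall>j. dF ?z $ j = x * F ?z $ j" ..
  then show ?thesis by (simp add: dF_def F_def)
qed

text \<open>\<open>K\<close> collects the cusps and \<open>R\<close> the flexes. The factorisation
  with real roots exhausts the complex zeros of the Wronskian, and the determinant of top
  coefficients settles infinity, so no parameter is left undecided.\<close>

lemma ramification_points:
  assumes inf: "det (vector [\<chi> k. coeff (f k) 4, \<chi> k. coeff (f k) 3, \<chi> k. coeff (f k) 2] :: real ^ 3 ^ 3) \<noteq> 0"
    and wr: "wronskian f = (\<Prod>r\<in>K. [:- r, 1:])\<^sup>2 * smult c (\<Prod>r\<in>R. [:- r, 1:])"
    and fin: "finite K" "finite R" "K \<inter> R = {}" "c \<noteq> 0"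
    and double: "\<And>r. r \<in> K \<Longrightarrow> \<exists>k. poly (q k) r = 0 \<and> disc k = 0"
  shows "{s. ramification_point \<phi> s} = (\<lambda>r. line_point (of_real r)) ` (K \<union> R)"
    "{s. cusp \<phi> s} = (\<lambda>r. line_point (of_real r)) ` K"
    "{s. flex \<phi> s} = (\<lambda>r. line_point (of_real r)) ` R"
proof -
  let ?W = "wronskian (\<lambda>k. cpoly (f k))"
  let ?p = "\<lambda>S. \<Prod>r\<in>S. [:- r, 1:] :: real poly"
  have W: "?W = cpoly (wronskian f)" by (rule wronskian_cpoly)
  have prod: "poly (?p S) r = 0 \<longleftrightarrow> r \<in> S" if "finite S" for S r
    using that by (auto simp: poly_prod)
  have root: "poly ?W z = 0 \<longleftrightarrow> z \<in> of_real ` (K \<union> R)" for z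
    using fin by (auto simp: W wr cpoly_mult cpoly_prod cpoly_smult poly_prod power2_eq_square map_poly_pCons)
  have flex: "has_ramification_sequence \<phi> (line_point (of_real r)) (0, 1, 3)" if "r \<in> R" for r
    unfolding \<phi>_def
  proof (rule ramification_at_wronskian_simple_root)
    show "poly ?W (of_real r) = 0" using that root by blast
    have "?p R = [:- r, 1:] * ?p (R - {r})"
      by (rule prod.remove[OF fin(2) that])
    then have "wronskian f = [:- r, 1:] * (?p K ^ 2 * smult c (?p (R - {r})))"
      by (simp only: wr mult_ac mult_smult_left mult_smult_right)
    then have "poly (pderiv (wronskian f)) r = poly (?p K ^ 2 * smult c (?p (R - {r}))) r"
      by (simp only: pderiv_mult poly_add poly_mult) (simp add: pderiv_pCons)
    also have "\<dots> \<noteq> 0"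
      using that fin by (auto simp: prod)
    finally show "poly (pderiv ?W) (of_real r) \<noteq> 0"
      by (simp add: W poly_cpoly_of_real flip: cpoly_pderiv)
  qed (rule degree_f)
  have cusp: "has_ramification_sequence \<phi> (line_point (of_real r)) (0, 2, 3)" if "r \<in> K" for r
  proof -
    have "\<exists>x. \<forall>j. poly (pderiv (cpoly (f j))) (of_real r) = x * poly (cpoly (f j)) (of_real r)"
      using double[OF that] pderiv_f_at_double_root by blast
    then obtain x where x: "\<And>j. poly (pderiv (cpoly (f j))) (of_real r) = x * poly (cpoly (f j)) (of_real r)"
      by blast
    show ?thesis
      unfolding \<phi>_def
    proof (rule ramification_at_wronskian_double_root[OF _ x])
      have "?p K = [:- r, 1:] * ?p (K - {r})"
        by (rule prod.remove[OF fin(1) that])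
      then have "wronskian f = [:- r, 1:] * ([:- r, 1:] * (?p (K - {r}) ^ 2 * smult c (?p R)))"
        by (simp only: wr power2_eq_square mult_ac)
      then have "poly (pderiv (pderiv (wronskian f))) r = 2 * poly (?p (K - {r}) ^ 2 * smult c (?p R)) r"
        by (simp only: pderiv_mult pderiv_add poly_add poly_mult) (simp add: pderiv_pCons)
      also have "\<dots> \<noteq> 0"
        using that fin by (auto simp: prod)
      finally show "poly (pderiv (pderiv ?W)) (of_real r) \<noteq> 0"
        by (simp add: W poly_cpoly_of_real flip: cpoly_pderiv)
    qed (rule degree_f)
  qed
  have other: "has_ramification_sequence \<phi> (line_point z) (0, 1, 2)" if "z \<notin> of_real ` (K \<union> R)" for z
    unfolding \<phi>_def using that root
    by (intro ramification_at_wronskian_nonroot degree_f) auto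
  have infinity: "has_ramification_sequence \<phi> line_infinity (0, 1, 2)"
  proof -
    let ?C = "\<lambda>j. \<chi> k. coeff (cpoly (f k)) j"
    have *: "det (vector [?C 4, ?C 3, ?C 2] :: complex ^ 3 ^ 3) =
        of_real (det (vector [\<chi> k. coeff (f k) 4, \<chi> k. coeff (f k) 3, \<chi> k. coeff (f k) 2] :: real ^ 3 ^ 3))"
      by (simp add: det_3 coeff_map_poly)
    have det: "det (vector [?C 4, ?C 3, ?C 2] :: complex ^ 3 ^ 3) \<noteq> 0"
      unfolding * using inf by (simp only: of_real_eq_0_iff not_False_eq_True)
    have suc: "Suc 2 = 3" "Suc 3 = 4" by simp_all
    show ?thesis
      unfolding \<phi>_def
      by (rule has_ramification_sequence_infinity[where d = 2 and f = "\<lambda>k. cpoly (f k)", unfolded suc, OF det])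
  qed
  let ?L = "\<lambda>r. line_point (complex_of_real r)"
  have in_P: "?L ` S \<subseteq> proj_points" for S
    unfolding proj_points_line by blast
  have "inj ?L" by (rule injI) simp
  then have "?L ` K \<inter> ?L ` R = {}"
    using fin(3) by (simp flip: image_Int)
  then have disjoint: "s \<in> ?L ` K \<Longrightarrow> s \<notin> ?L ` R" for s
    by blast
  \<comment> \<open>One sequence is assigned to every parameter; uniqueness turns this into an
    equivalence, and each of the three sets follows by comparing values.\<close>
  define seq where "seq s = (if s \<in> ?L ` K then (0, 2, 3) else if s \<in> ?L ` R then (0, 1, 3) else (0 :: nat, 1 :: nat, 2 :: nat))" for s
  have "has_ramification_sequence \<phi> s (seq s)" if "s \<in> proj_points" for s
  proof -
    consider "s \<in> ?L ` K" | "s \<notin> ?L ` K" "s \<in> ?L ` R" | "s \<notin> ?L ` (K \<union> R)"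
      by blast
    then show ?thesis
    proof cases
      case 1
      then obtain r where "r \<in> K" "s = ?L r" by blast
      with 1 cusp[of r] show ?thesis by (simp only: seq_def if_True)
    next
      case 2
      then obtain r where "r \<in> R" "s = ?L r" by blast
      with 2 flex[of r] show ?thesis by (simp only: seq_def if_True if_False)
    next
      case 3
      then have notin: "s \<notin> ?L ` K" "s \<notin> ?L ` R" by blast+
      have "s = line_infinity \<or> (\<exists>z. s = line_point z \<and> z \<notin> of_real ` (K \<union> R))"
        using \<open>s \<in> proj_points\<close> 3 unfolding proj_points_line by blast
      then have "has_ramification_sequence \<phi> s (0, 1, 2)"
        using other infinity by blast
      with notin show ?thesis by (simp only: seq_def if_False)
    qed
  qed
  then have iff: "s \<in> proj_points \<and> has_ramification_sequence \<phi> s a \<longleftrightarrow> s \<in> proj_points \<and> a = seq s" for s a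
    by (metis has_ramification_sequence_unique prod_cases3)
  show "{s. ramification_point \<phi> s} = ?L ` (K \<union> R)"
  proof (rule set_eqI)
    fix s
    have "ramification_point \<phi> s \<longleftrightarrow> s \<in> proj_points \<and> seq s \<noteq> (0, 1, 2)"
      using iff[of s "(0, 1, 2)"] by (auto simp only: ramification_point_def)
    also have "\<dots> \<longleftrightarrow> s \<in> ?L ` (K \<union> R)"
      using in_P[of K] in_P[of R] by (auto simp only: seq_def image_Un split: if_splits)
    finally show "s \<in> {s. ramification_point \<phi> s} \<longleftrightarrow> s \<in> ?L ` (K \<union> R)" by simp
  qed
  show "{s. cusp \<phi> s} = ?L ` K"
  proof (rule set_eqI)
    fix s
    show "s \<in> {s. cusp \<phi> s} \<longleftrightarrow> s \<in> ?L ` K"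
      using in_P[of K] unfolding mem_Collect_eq cusp_def iff by (cases "s \<in> ?L ` K") (auto simp: seq_def)
  qed
  show "{s. flex \<phi> s} = ?L ` R"
  proof (rule set_eqI)
    fix s
    show "s \<in> {s. flex \<phi> s} \<longleftrightarrow> s \<in> ?L ` R"
      using in_P[of R] disjoint[of s] unfolding mem_Collect_eq flex_def iff by (cases "s \<in> ?L ` R") (auto simp: seq_def)
  qed
qed

lemma f_simps: "f 1 = q 2 * q 3" "f 2 = q 3 * q 1" "f 3 = q 1 * q 2"
  by (simp_all add: f_def numeral_mod_3)

text \<open>The certificate for an example: \<open>V\<close> is the Wronskian without the double
  roots at the cusps, and the iota + 1 sample points separate the flexes. Nonvanishing of
  \<open>V\<close> on \<open>K\<close> makes the roots there exactly double. For iota = 0 there are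
  no sign changes, and \<open>V \<noteq> 0\<close> is what excludes a zero Wronskian.\<close>

lemma quartic_with_counts:
  fixes V :: "real poly" and K :: "real set" and x :: "nat \<Rightarrow> real"
  assumes "det (vector [\<chi> k. coeff (f k) 4, \<chi> k. coeff (f k) 3, \<chi> k. coeff (f k) 2] :: real ^ 3 ^ 3) \<noteq> 0"
    and wr: "wronskian f = (\<Prod>r\<in>K. [:- r, 1:])\<^sup>2 * V"
    and K: "finite K" "card K = \<kappa>" "\<And>r. r \<in> K \<Longrightarrow> poly V r \<noteq> 0"
      "\<And>r. r \<in> K \<Longrightarrow> \<exists>k. poly (q k) r = 0 \<and> disc k = 0"
    and V: "V \<noteq> 0" "degree V \<le> \<iota>"
      "\<forall>i<\<iota>. x i < x (Suc i) \<and> poly V (x i) * poly V (x (Suc i)) < 0"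
    and disc: "card {k. disc k > 0} = \<eta>" "card {k. disc k < 0} = \<delta>"
  shows "realizable \<kappa> \<iota> \<eta> \<delta>"
  unfolding realizable_def
proof -
  obtain R where R: "finite R" "card R = \<iota>" and V': "V = smult (coeff V \<iota>) (\<Prod>r\<in>R. [:- r, 1:])"
    by (rule sign_changes_imp_simple_roots[of \<iota> x V]) (use V(2,3) in auto)
  from V' obtain c where Vc: "V = smult c (\<Prod>r\<in>R. [:- r, 1:])" ..
  have c: "c \<noteq> 0"
    using Vc V(1) by auto
  have "poly V r = 0" if "r \<in> R" for r
    using R(1) that by (simp add: Vc poly_prod)
  then have "K \<inter> R = {}" using K(3) by blast
  note ram = ramification_points[OF assms(1) wr[unfolded Vc] K(1) R(1) this c K(4)]
  have inj: "inj_on (\<lambda>r. line_point (complex_of_real r)) S" for S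
    by (rule inj_onI) simp
  show "\<exists>\<phi>. maximally_inflected_quartic \<phi> \<and> has_exactly \<kappa> {s. cusp \<phi> s} \<and>
    has_exactly \<iota> {s. flex \<phi> s} \<and> has_exactly \<eta> {P. real_node \<phi> P} \<and>
    has_exactly \<delta> {P. solitary_point \<phi> P}"
  proof (intro exI conjI)
    have "{s. ramification_point \<phi> s} \<subseteq> Collect real_subspace"
      by (subst ram(1)) (auto simp: real_subspace_line_point)
    then show "maximally_inflected_quartic \<phi>"
      by (auto simp: maximally_inflected_quartic_def rational_plane_quartic real_coefficients)
    show "has_exactly \<kappa> {s. cusp \<phi> s}" "has_exactly \<iota> {s. flex \<phi> s}"
      using K(1,2) R by (simp_all add: ram has_exactly_def card_image[OF inj])
    show "has_exactly \<eta> {P. real_node \<phi> P}" "has_exactly \<delta> {P. solitary_point \<phi> P}"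
      using has_exactly_axis_points[of "\<lambda>k. disc k > 0"] has_exactly_axis_points[of "\<lambda>k. disc k < 0"]
      by (simp_all add: real_nodes solitary_points disc)
  qed
qed

end

subsection \<open>The seven examples\<close>

text \<open>The reflection t -> -t fixes \<open>q 1\<close> and exchanges \<open>q 2\<close> and
  \<open>q 3\<close>. This makes the Wronskian even, so symmetric sample points suffice.\<close>

lemma realizable_0_6_0_3: "realizable 0 6 0 3"
proof -
  interpret cremona_quartic "vector [vector [1, 0, 1], vector [3, 3, 1], vector [3, -3, 1]]"
    by unfold_locales (simp_all only: atomize_all, simp_all add: det_3 forall_3 numeral_mod_3)
  have q: "q 1 = [:1, 0, 1:]" "q 2 = [:3, 3, 1:]" "q 3 = [:3, -3, 1:]"
    by (simp_all add: q_def)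
  show ?thesis
  proof (rule quartic_with_counts)
    show "wronskian f = (\<Prod>r\<in>{}. [:- r, 1:])\<^sup>2 * [:-540, 0, 1188, 0, -684, 0, 84:]"
      by (simp add: wronskian_def det_3 f_simps q pderiv_pCons power2_eq_square)
    let ?x = "(!) [-3, -2, -1, 0, 1, 2, 3] :: nat \<Rightarrow> real"
    show "\<forall>i<6. ?x i < ?x (Suc i) \<and> poly [:-540, 0, 1188, 0, -684, 0, 84:] (?x i) * poly [:-540, 0, 1188, 0, -684, 0, 84:] (?x (Suc i)) < 0"
      by (simp add: eval_nat_numeral less_Suc_eq all_conj_distrib)
  qed (auto simp: f_simps q det_3 card_3 ex_3 disc_def coeff_pCons_numeral)
qed

text \<open>Only the constant term of \<open>q 1\<close> changes from the previous example; its
  discriminant becomes positive, and a solitary point turns into a real node.\<close>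

lemma realizable_0_6_1_2: "realizable 0 6 1 2"
proof -
  interpret cremona_quartic "vector [vector [-3, 0, 1], vector [3, 3, 1], vector [3, -3, 1]]"
    by unfold_locales (simp_all only: atomize_all, simp_all add: det_3 forall_3 numeral_mod_3)
  have q: "q 1 = [:-3, 0, 1:]" "q 2 = [:3, 3, 1:]" "q 3 = [:3, -3, 1:]"
    by (simp_all add: q_def)
  show ?thesis
  proof (rule quartic_with_counts)
    show "wronskian f = (\<Prod>r\<in>{}. [:- r, 1:])\<^sup>2 * [:-972, 0, 2916, 0, -972, 0, 36:]"
      by (simp add: wronskian_def det_3 f_simps q pderiv_pCons power2_eq_square)
    let ?x = "(!) [-5, -2, -1, 0, 1, 2, 5] :: nat \<Rightarrow> real"
    show "\<forall>i<6. ?x i < ?x (Suc i) \<and> poly [:-972, 0, 2916, 0, -972, 0, 36:] (?x i) * poly [:-972, 0, 2916, 0, -972, 0, 36:] (?x (Suc i)) < 0"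
      by (simp add: eval_nat_numeral less_Suc_eq all_conj_distrib)
  qed (auto simp: f_simps q det_3 card_3 ex_3 disc_def coeff_pCons_numeral)
qed

text \<open>The quadratic fixed by the reflection is now a square, and its double root 0 is the
  cusp.\<close>

lemma realizable_1_4_0_2: "realizable 1 4 0 2"
proof -
  interpret cremona_quartic "vector [vector [0, 0, 1], vector [2, 2, 1], vector [2, -2, 1]]"
    by unfold_locales (simp_all only: atomize_all, simp_all add: det_3 forall_3 numeral_mod_3)
  have q: "q 1 = [:0, 0, 1:]" "q 2 = [:2, 2, 1:]" "q 3 = [:2, -2, 1:]"
    by (simp_all add: q_def)
  show ?thesis
  proof (rule quartic_with_counts)
    show "wronskian f = (\<Prod>r\<in>{0}. [:- r, 1:])\<^sup>2 * [:192, 0, -192, 0, 16:]"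
      by (simp add: wronskian_def det_3 f_simps q pderiv_pCons power2_eq_square)
    let ?x = "(!) [-4, -2, 0, 2, 4] :: nat \<Rightarrow> real"
    show "\<forall>i<4. ?x i < ?x (Suc i) \<and> poly [:192, 0, -192, 0, 16:] (?x i) * poly [:192, 0, -192, 0, 16:] (?x (Suc i)) < 0"
      by (simp add: eval_nat_numeral less_Suc_eq all_conj_distrib)
  qed (auto simp: f_simps q det_3 card_3 ex_3 disc_def coeff_pCons_numeral)
qed

text \<open>The symmetry is impossible here. The three discriminants have different signs, so t ->
  -t would preserve each quadratic up to a factor; having nonzero leading terms, all three would be
  even and \<open>det M\<close> would be zero.\<close>

lemma realizable_1_4_1_1: "realizable 1 4 1 1"
proof -
  interpret cremona_quartic "vector [vector [0, 0, 1], vector [3, -3, 1], vector [-1, -3, 3]]"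
    by unfold_locales (simp_all only: atomize_all, simp_all add: det_3 forall_3 numeral_mod_3)
  have q: "q 1 = [:0, 0, 1:]" "q 2 = [:3, -3, 1:]" "q 3 = [:-1, -3, 3:]"
    by (simp_all add: q_def)
  show ?thesis
  proof (rule quartic_with_counts)
    show "wronskian f = (\<Prod>r\<in>{0}. [:- r, 1:])\<^sup>2 * [:-216, 336, 144, -216, 36:]"
      by (simp add: wronskian_def det_3 f_simps q pderiv_pCons power2_eq_square)
    let ?x = "(!) [-2, 0, 1, 2, 5] :: nat \<Rightarrow> real"
    show "\<forall>i<4. ?x i < ?x (Suc i) \<and> poly [:-216, 336, 144, -216, 36:] (?x i) * poly [:-216, 336, 144, -216, 36:] (?x (Suc i)) < 0"
      by (simp add: eval_nat_numeral less_Suc_eq all_conj_distrib)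
  qed (auto simp: f_simps q det_3 card_3 ex_3 disc_def coeff_pCons_numeral)
qed

text \<open>The reflection exchanges two squares, which give cusps at 1 and -1. The even quadratic
  \<open>q 3\<close> decides the third vertex: its constant term is positive here, negative for the
  node in the next example, and zero for the third cusp in the last.\<close>

lemma realizable_2_2_0_1: "realizable 2 2 0 1"
proof -
  interpret cremona_quartic "vector [vector [1, -2, 1], vector [1, 2, 1], vector [2, 0, 1]]"
    by unfold_locales (simp_all only: atomize_all, simp_all add: det_3 forall_3 numeral_mod_3)
  have q: "q 1 = [:1, -2, 1:]" "q 2 = [:1, 2, 1:]" "q 3 = [:2, 0, 1:]"
    by (simp_all add: q_def)
  show ?thesis
  proof (rule quartic_with_counts)
    show "wronskian f = (\<Prod>r\<in>{1, -1}. [:- r, 1:])\<^sup>2 * [:112, 0, -40:]"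
      by (simp add: wronskian_def det_3 f_simps q pderiv_pCons power2_eq_square)
    let ?x = "(!) [-2, 0, 2] :: nat \<Rightarrow> real"
    show "\<forall>i<2. ?x i < ?x (Suc i) \<and> poly [:112, 0, -40:] (?x i) * poly [:112, 0, -40:] (?x (Suc i)) < 0"
      by (simp add: eval_nat_numeral less_Suc_eq all_conj_distrib)
  qed (auto simp: f_simps q det_3 card_3 ex_3 disc_def coeff_pCons_numeral)
qed

lemma realizable_2_2_1_0: "realizable 2 2 1 0"
proof -
  interpret cremona_quartic "vector [vector [1, -2, 1], vector [1, 2, 1], vector [-2, 0, 1]]"
    by unfold_locales (simp_all only: atomize_all, simp_all add: det_3 forall_3 numeral_mod_3)
  have q: "q 1 = [:1, -2, 1:]" "q 2 = [:1, 2, 1:]" "q 3 = [:-2, 0, 1:]"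
    by (simp_all add: q_def)
  show ?thesis
  proof (rule quartic_with_counts)
    show "wronskian f = (\<Prod>r\<in>{1, -1}. [:- r, 1:])\<^sup>2 * [:80, 0, -8:]"
      by (simp add: wronskian_def det_3 f_simps q pderiv_pCons power2_eq_square)
    let ?x = "(!) [-4, 0, 4] :: nat \<Rightarrow> real"
    show "\<forall>i<2. ?x i < ?x (Suc i) \<and> poly [:80, 0, -8:] (?x i) * poly [:80, 0, -8:] (?x (Suc i)) < 0"
      by (simp add: eval_nat_numeral less_Suc_eq all_conj_distrib)
  qed (auto simp: f_simps q det_3 card_3 ex_3 disc_def coeff_pCons_numeral)
qed

lemma realizable_3_0_0_0: "realizable 3 0 0 0"
proof -
  interpret cremona_quartic "vector [vector [1, -2, 1], vector [1, 2, 1], vector [0, 0, 1]]"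
    by unfold_locales (simp_all only: atomize_all, simp_all add: det_3 forall_3 numeral_mod_3)
  have q: "q 1 = [:1, -2, 1:]" "q 2 = [:1, 2, 1:]" "q 3 = [:0, 0, 1:]"
    by (simp_all add: q_def)
  show ?thesis
  proof (rule quartic_with_counts)
    show "wronskian f = (\<Prod>r\<in>{1, -1, 0}. [:- r, 1:])\<^sup>2 * [:-24:]"
      by (simp add: wronskian_def det_3 f_simps q pderiv_pCons power2_eq_square)
    \<comment> \<open>The three double roots use up the whole degree 6, so \<open>V\<close> is
      constant and there is no sign change to certify.\<close>
    let ?x = "(!) [0] :: nat \<Rightarrow> real"
    show "\<forall>i<0. ?x i < ?x (Suc i) \<and> poly [:-24:] (?x i) * poly [:-24:] (?x (Suc i)) < 0"
      by (simp add: eval_nat_numeral less_Suc_eq all_conj_distrib)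
  qed (auto simp: f_simps q det_3 card_3 ex_3 disc_def coeff_pCons_numeral)
qed

theorem theorem5p1:
  fixes \<kappa> \<iota> \<eta> \<delta> :: nat
  assumes "(\<kappa>, \<iota>, \<eta>, \<delta>) \<in>
    {(0, 6, 0, 3), (0, 6, 1, 2), (1, 4, 0, 2), (1, 4, 1, 1), (2, 2, 0, 1), (2, 2, 1, 0), (3, 0, 0, 0)}"
  shows "\<exists>\<phi> :: (complex poly poly) ^ 3.
    maximally_inflected_quartic \<phi> \<and>
    has_exactly \<kappa> {s. cusp \<phi> s} \<and>
    has_exactly \<iota> {s. flex \<phi> s} \<and>
    has_exactly \<eta> {P. real_node \<phi> P} \<and>
    has_exactly \<delta> {P. solitary_point \<phi> P}"
proof -
  have "realizable \<kappa> \<iota> \<eta> \<delta>"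
    using assms realizable_0_6_0_3 realizable_0_6_1_2 realizable_1_4_0_2 realizable_1_4_1_1
      realizable_2_2_0_1 realizable_2_2_1_0 realizable_3_0_0_0 by auto
  then show ?thesis by (simp only: realizable_def)
qed

end
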